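(* Let $X$ be a nonzero $C^1$ vector field on a closed manifold $M$. If $X$ is k*-expansive and $Sing(X)$ is dynamically isolated, then $$\limsup_{t\to\infty}\frac{1}{t}\log v(t)\leq e^*(X),$$ where $v(t)$ is the number of periodic orbits of $X$ of period $\leq t$ and $e^*(X)$ is the rescaled topological entropy of $X$.
   Context: A closed manifold is a compact connected boundaryless manifold of positive dimension equipped with a Riemannian metric; $\|\cdot\|$ and $d$ denote the induced norm on $TM$ and distance on $M$. $\varphi_t$ is the flow generated by $X$, $Sing(X)=\{x\in M: X(x)=0\}$, $M^*=M\setminus Sing(X)$, $M_\epsilon=\{x\in M:\|X(x)\|\ge\epsilon\}$. Rescaled topological entropy: for $t\ge 0$, $x\in M^*$, $y\in M$ put $$d^*_t(x,y)=\sup_{0\le s\le t}\frac{d(\varphi_s(x),\varphi_s(y))}{\|X(\varphi_s(x))\|},\qquad B^*(x,t,\epsilon)=\{y\in M: d_t^*(x,y)<\epsilon\}.$$ A set $F\subset M^*$ is rescaled $(t,\epsilon)$-spanning if $M_\epsilon\subset\bigcup_{x\in F}B^*(x,t,\epsilon)$; $R^*(t,\epsilon)$ is the minimal cardinality of a rescaled $(t,\epsilon)$-spanning set (it is finite). Define $e^*(X)=\lim_{\epsilon\to0}\limsup_{t\to\infty}\frac1t\log R^*(t,\epsilon)$. k*-expansive: for every $\epsilon>0$ there is $\delta>0$ such that if $x,y\in M$ satisfy $d(\varphi_s(x),\varphi_{h(s)}(y))\le\delta$ for every $s\in\mathbb R$ and some increasing homeomorphism $h:\mathbb R\to\mathbb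 R$ with $h(0)=0$, then $\varphi_{h(s_0)}(y)\in\varphi_{[s_0-\epsilon,s_0+\epsilon]}(x)$ for some $s_0\in\mathbb R$. Periodic orbits: $x$ is a periodic point if there is a minimal $t>0$ (its period) with $\varphi_t(x)=x$ (so singularities are not periodic points); a periodic orbit is the orbit of a periodic point, with the same period. $Sing(X)$ is dynamically isolated if there is a neighborhood $U$ of $Sing(X)$ with $\bigcap_{t\in\mathbb R}\varphi_t(U)=Sing(X)$. Convention: $\log 0=-\infty$. *)

theory Defs
  imports "HOL-Analysis.Analysis" "HOL-Library.Extended_Nat"
begin

section \<open>Closed Riemannian manifolds\<close>

text \<open>
  \<open>Ck_on k S f\<close> is meant for open \<open>S\<close> in a finite-dimensional space, where continuity of all
  iterated directional derivatives is the same as being of class \<open>C\<^sup>k\<close>.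
\<close>

primrec Ck_on ::
    "nat \<Rightarrow> 'e::euclidean_space set \<Rightarrow> ('e \<Rightarrow> 'b::real_normed_vector) \<Rightarrow> bool" where
  "Ck_on 0 S f \<longleftrightarrow> continuous_on S f"
| "Ck_on (Suc k) S f \<longleftrightarrow>
     (\<forall>z\<in>S. f differentiable (at z)) \<and> (\<forall>v. Ck_on k S (\<lambda>z. frechet_derivative f (at z) v))"

definition smooth_on :: "'e::euclidean_space set \<Rightarrow> ('e \<Rightarrow> 'b::real_normed_vector) \<Rightarrow> bool" where
  "smooth_on S f \<longleftrightarrow> (\<forall>k. Ck_on k S f)"

text \<open>A chart is a pair of its domain and its coordinate map.\<close>

type_synonym ('a, 'e) chart = "'a set \<times> ('a \<Rightarrow> 'e)"

definition chart_inv :: "('a, 'e) chart \<Rightarrow> 'e \<Rightarrow> 'a" where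
  "chart_inv c = inv_into (fst c) (snd c)"

text \<open>
  A tangent vector at \<open>p\<close> is represented by the family of its coordinate vectors in all charts of the
  atlas around \<open>p\<close>, related to each other by the derivatives of the transition maps. The entries at
  all other charts are set to \<open>0\<close>, so that equality and vanishing of tangent vectors are equality and
  vanishing of functions.
\<close>

type_synonym ('a, 'e) tvec = "('a, 'e) chart \<Rightarrow> 'e"

record ('a, 'e) riem_mfd =
  top_of :: "'a topology"
  atlas :: "('a, 'e) chart set"
  metric :: "'a \<Rightarrow> ('a, 'e) tvec \<Rightarrow> ('a, 'e) tvec \<Rightarrow> real"

abbreviation points :: "('a, 'e) riem_mfd \<Rightarrow> 'a set" where
  "points M \<equiv> topspace (top_of M)"

definition transition_deriv ::
    "('a, 'e::euclidean_space) chart \<Rightarrow> ('a, 'e) chart \<Rightarrow> 'a \<Rightarrow> 'e \<Rightarrow> 'e" where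
  "transition_deriv c c' p = frechet_derivative (snd c' \<circ> chart_inv c) (at (snd c p))"

definition smooth_atlas :: "'a topology \<Rightarrow> ('a, 'e::euclidean_space) chart set \<Rightarrow> bool" where
  "smooth_atlas T A \<longleftrightarrow>
     (\<Union>c\<in>A. fst c) = topspace T \<and>
     (\<forall>(U, \<kappa>)\<in>A. openin T U \<and> open (\<kappa> ` U) \<and>
        homeomorphic_map (subtopology T U) (top_of_set (\<kappa> ` U)) \<kappa>) \<and>
     (\<forall>c\<in>A. \<forall>c'\<in>A. smooth_on (snd c ` (fst c \<inter> fst c')) (snd c' \<circ> chart_inv c))"

definition tangent_space :: "('a, 'e::euclidean_space) riem_mfd \<Rightarrow> 'a \<Rightarrow> ('a, 'e) tvec set" where
  "tangent_space M p = {v.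
     (\<forall>c. \<not> (c \<in> atlas M \<and> p \<in> fst c) \<longrightarrow> v c = 0) \<and>
     (\<forall>c\<in>atlas M. \<forall>c'\<in>atlas M. p \<in> fst c \<inter> fst c' \<longrightarrow> v c' = transition_deriv c c' p (v c))}"

text \<open>The tangent vector at \<open>p\<close> whose coordinate vector in the chart \<open>c\<close> is \<open>w\<close>.\<close>

definition tvec_of ::
    "('a, 'e::euclidean_space) riem_mfd \<Rightarrow> ('a, 'e) chart \<Rightarrow> 'a \<Rightarrow> 'e \<Rightarrow> ('a, 'e) tvec" where
  "tvec_of M c p w =
     (\<lambda>c'. if c' \<in> atlas M \<and> p \<in> fst c' then transition_deriv c c' p w else 0)"

definition riemannian_metric :: "('a, 'e::euclidean_space) riem_mfd \<Rightarrow> bool" where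
  "riemannian_metric M \<longleftrightarrow>
     (\<forall>p\<in>points M. \<forall>u\<in>tangent_space M p. \<forall>v\<in>tangent_space M p.
        metric M p u v = metric M p v u \<and>
        (\<forall>w\<in>tangent_space M p. \<forall>r.
           metric M p (\<lambda>c. r *\<^sub>R u c + v c) w = r * metric M p u w + metric M p v w) \<and>
        (u \<noteq> (\<lambda>c. 0) \<longrightarrow> metric M p u u > 0)) \<and>
     (\<forall>c\<in>atlas M. \<forall>v w. smooth_on (snd c ` fst c)
        (\<lambda>z. metric M (chart_inv c z) (tvec_of M c (chart_inv c z) v)
                                      (tvec_of M c (chart_inv c z) w)))"

text \<open>
  The model space has positive dimension since \<open>'e\<close> is of class \<open>euclidean_space\<close>, and there is no
  boundary since charts map onto open subsets of \<open>'e\<close>. Second countability follows from compactness.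
\<close>

definition closed_riem_manifold :: "('a, 'e::euclidean_space) riem_mfd \<Rightarrow> bool" where
  "closed_riem_manifold M \<longleftrightarrow>
     points M \<noteq> {} \<and> Hausdorff_space (top_of M) \<and> compact_space (top_of M) \<and>
     connected_space (top_of M) \<and> smooth_atlas (top_of M) (atlas M) \<and> riemannian_metric M"

definition tnorm :: "('a, 'e) riem_mfd \<Rightarrow> 'a \<Rightarrow> ('a, 'e) tvec \<Rightarrow> real" where
  "tnorm M p v = sqrt (metric M p v v)"

subsection \<open>Riemannian distance\<close>

definition C1_curve_on :: "('a, 'e::euclidean_space) riem_mfd \<Rightarrow> real set \<Rightarrow> (real \<Rightarrow> 'a) \<Rightarrow> bool" where
  "C1_curve_on M I \<gamma> \<longleftrightarrow>
     continuous_map (top_of_set I) (top_of M) \<gamma> \<and>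
     (\<forall>(U, \<kappa>)\<in>atlas M. \<exists>D. continuous_on (I \<inter> \<gamma> -` U) D \<and>
        (\<forall>s\<in>I \<inter> \<gamma> -` U. ((\<kappa> \<circ> \<gamma>) has_vector_derivative D s) (at s within I)))"

text \<open>
  The finite set \<open>S\<close> is the subdivision of \<open>{a..b}\<close>; the curve is \<open>C\<^sup>1\<close> up to the end points on each
  of the closed subintervals.
\<close>

definition piecewise_C1_curve ::
    "('a, 'e::euclidean_space) riem_mfd \<Rightarrow> real \<Rightarrow> real \<Rightarrow> (real \<Rightarrow> 'a) \<Rightarrow> bool" where
  "piecewise_C1_curve M a b \<gamma> \<longleftrightarrow> a < b \<and>
     (\<exists>S. finite S \<and> {a, b} \<subseteq> S \<and> S \<subseteq> {a..b} \<and>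
        (\<forall>s\<in>S. \<forall>t\<in>S. s < t \<and> {s<..<t} \<inter> S = {} \<longrightarrow> C1_curve_on M {s..t} \<gamma>))"

definition velocity ::
    "('a, 'e::euclidean_space) riem_mfd \<Rightarrow> (real \<Rightarrow> 'a) \<Rightarrow> real \<Rightarrow> ('a, 'e) tvec" where
  "velocity M \<gamma> s =
     (\<lambda>c. if c \<in> atlas M \<and> \<gamma> s \<in> fst c then vector_derivative (snd c \<circ> \<gamma>) (at s) else 0)"

text \<open>
  The velocity is unspecified at \<open>a\<close>, \<open>b\<close> and the break points of \<open>\<gamma>\<close>, which form a finite set and
  do not affect the integral.
\<close>

definition curve_length ::
    "('a, 'e::euclidean_space) riem_mfd \<Rightarrow> real \<Rightarrow> real \<Rightarrow> (real \<Rightarrow> 'a) \<Rightarrow> real" where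
  "curve_length M a b \<gamma> = integral {a..b} (\<lambda>s. tnorm M (\<gamma> s) (velocity M \<gamma> s))"

definition riem_dist :: "('a, 'e::euclidean_space) riem_mfd \<Rightarrow> 'a \<Rightarrow> 'a \<Rightarrow> real" where
  "riem_dist M x y =
     Inf {curve_length M a b \<gamma> | a b \<gamma>. piecewise_C1_curve M a b \<gamma> \<and> \<gamma> a = x \<and> \<gamma> b = y}"

section \<open>Vector fields and flows\<close>

type_synonym ('a, 'e) vfield = "'a \<Rightarrow> ('a, 'e) tvec"

definition C1_vector_field :: "('a, 'e::euclidean_space) riem_mfd \<Rightarrow> ('a, 'e) vfield \<Rightarrow> bool" where
  "C1_vector_field M X \<longleftrightarrow>
     (\<forall>p\<in>points M. X p \<in> tangent_space M p) \<and>
     (\<forall>c\<in>atlas M. Ck_on 1 (snd c ` fst c) (\<lambda>z. X (chart_inv c z) c))"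

definition flow_generated_by ::
    "('a, 'e::euclidean_space) riem_mfd \<Rightarrow> ('a, 'e) vfield \<Rightarrow> (real \<Rightarrow> 'a \<Rightarrow> 'a) \<Rightarrow> bool" where
  "flow_generated_by M X \<phi> \<longleftrightarrow>
     continuous_map (prod_topology euclideanreal (top_of M)) (top_of M) (\<lambda>(t, x). \<phi> t x) \<and>
     (\<forall>x\<in>points M. \<phi> 0 x = x) \<and>
     (\<forall>x\<in>points M. \<forall>s t. \<phi> (s + t) x = \<phi> s (\<phi> t x)) \<and>
     (\<forall>x\<in>points M. \<forall>t. \<forall>c\<in>atlas M. \<phi> t x \<in> fst c \<longrightarrow>
        ((\<lambda>s. snd c (\<phi> s x)) has_vector_derivative X (\<phi> t x) c) (at t))"

definition Sing :: "('a, 'e::euclidean_space) riem_mfd \<Rightarrow> ('a, 'e) vfield \<Rightarrow> 'a set" where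
  "Sing M X = {x \<in> points M. X x = (\<lambda>c. 0)}"

definition nonsing :: "('a, 'e::euclidean_space) riem_mfd \<Rightarrow> ('a, 'e) vfield \<Rightarrow> 'a set" where
  "nonsing M X = points M - Sing M X"

definition speed_ge :: "('a, 'e::euclidean_space) riem_mfd \<Rightarrow> ('a, 'e) vfield \<Rightarrow> real \<Rightarrow> 'a set" where
  "speed_ge M X \<epsilon> = {x \<in> points M. tnorm M x (X x) \<ge> \<epsilon>}"

definition dynamically_isolated_Sing ::
    "('a, 'e::euclidean_space) riem_mfd \<Rightarrow> ('a, 'e) vfield \<Rightarrow> (real \<Rightarrow> 'a \<Rightarrow> 'a) \<Rightarrow> bool" where
  "dynamically_isolated_Sing M X \<phi> \<longleftrightarrow>
     (\<exists>U W. openin (top_of M) W \<and> Sing M X \<subseteq> W \<and> W \<subseteq> U \<and> U \<subseteq> points M \<and>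
        (\<Inter>t. \<phi> t ` U) = Sing M X)"

definition kstar_expansive ::
    "('a, 'e::euclidean_space) riem_mfd \<Rightarrow> (real \<Rightarrow> 'a \<Rightarrow> 'a) \<Rightarrow> bool" where
  "kstar_expansive M \<phi> \<longleftrightarrow>
     (\<forall>\<epsilon>>0. \<exists>\<delta>>0. \<forall>x\<in>points M. \<forall>y\<in>points M. \<forall>h h'.
        homeomorphism (UNIV :: real set) (UNIV :: real set) h h' \<and> strict_mono h \<and> h 0 = 0 \<and>
        (\<forall>s. riem_dist M (\<phi> s x) (\<phi> (h s) y) \<le> \<delta>) \<longrightarrow>
        (\<exists>s0. \<phi> (h s0) y \<in> (\<lambda>s. \<phi> s x) ` {s0 - \<epsilon>..s0 + \<epsilon>}))"

section \<open>Rescaled topological entropy\<close>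

definition ecard :: "'a set \<Rightarrow> enat" where
  "ecard A = (if finite A then enat (card A) else \<infinity>)"

definition log_enat :: "enat \<Rightarrow> ereal" where
  "log_enat n = (case n of enat k \<Rightarrow> if k = 0 then - \<infinity> else ereal (ln (real k)) | \<infinity> \<Rightarrow> \<infinity>)"

definition rescaled_dist ::
    "('a, 'e::euclidean_space) riem_mfd \<Rightarrow> ('a, 'e) vfield \<Rightarrow> (real \<Rightarrow> 'a \<Rightarrow> 'a) \<Rightarrow>
     real \<Rightarrow> 'a \<Rightarrow> 'a \<Rightarrow> ereal" where
  "rescaled_dist M X \<phi> t x y =
     (SUP s\<in>{0..t}. ereal (riem_dist M (\<phi> s x) (\<phi> s y) / tnorm M (\<phi> s x) (X (\<phi> s x))))"

definition rescaled_ball ::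
    "('a, 'e::euclidean_space) riem_mfd \<Rightarrow> ('a, 'e) vfield \<Rightarrow> (real \<Rightarrow> 'a \<Rightarrow> 'a) \<Rightarrow>
     'a \<Rightarrow> real \<Rightarrow> real \<Rightarrow> 'a set" where
  "rescaled_ball M X \<phi> x t \<epsilon> = {y \<in> points M. rescaled_dist M X \<phi> t x y < ereal \<epsilon>}"

definition rescaled_spanning ::
    "('a, 'e::euclidean_space) riem_mfd \<Rightarrow> ('a, 'e) vfield \<Rightarrow> (real \<Rightarrow> 'a \<Rightarrow> 'a) \<Rightarrow>
     real \<Rightarrow> real \<Rightarrow> 'a set \<Rightarrow> bool" where
  "rescaled_spanning M X \<phi> t \<epsilon> F \<longleftrightarrow>
     F \<subseteq> nonsing M X \<and> speed_ge M X \<epsilon> \<subseteq> (\<Union>x\<in>F. rescaled_ball M X \<phi> x t \<epsilon>)"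

definition min_spanning ::
    "('a, 'e::euclidean_space) riem_mfd \<Rightarrow> ('a, 'e) vfield \<Rightarrow> (real \<Rightarrow> 'a \<Rightarrow> 'a) \<Rightarrow>
     real \<Rightarrow> real \<Rightarrow> enat" where
  "min_spanning M X \<phi> t \<epsilon> = (INF F\<in>{F. rescaled_spanning M X \<phi> t \<epsilon> F}. ecard F)"

definition rescaled_entropy ::
    "('a, 'e::euclidean_space) riem_mfd \<Rightarrow> ('a, 'e) vfield \<Rightarrow> (real \<Rightarrow> 'a \<Rightarrow> 'a) \<Rightarrow> ereal" where
  "rescaled_entropy M X \<phi> =
     Lim (at_right 0) (\<lambda>\<epsilon>::real. Limsup at_top
       (\<lambda>t::real. ereal (1 / t) * log_enat (min_spanning M X \<phi> t \<epsilon>)))"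

section \<open>Periodic orbits\<close>

definition is_period :: "(real \<Rightarrow> 'a \<Rightarrow> 'a) \<Rightarrow> 'a \<Rightarrow> real \<Rightarrow> bool" where
  "is_period \<phi> x p \<longleftrightarrow> p > 0 \<and> \<phi> p x = x \<and> (\<forall>s. 0 < s \<and> s < p \<longrightarrow> \<phi> s x \<noteq> x)"

definition num_periodic_orbits ::
    "('a, 'e::euclidean_space) riem_mfd \<Rightarrow> (real \<Rightarrow> 'a \<Rightarrow> 'a) \<Rightarrow> real \<Rightarrow> enat" where
  "num_periodic_orbits M \<phi> t =
     ecard {range (\<lambda>s. \<phi> s x) | x. x \<in> points M \<and> (\<exists>p. is_period \<phi> x p \<and> p \<le> t)}"

end

theory Submission
  imports Defs "HOL-Real_Asymp.Real_Asymp"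
begin

text \<open>
  The singularities have an open neighbourhood outside which the speed is bounded below and in which
  no periodic orbit is contained, so every periodic orbit has a point of speed at least \<open>e\<close>, for a
  fixed \<open>e > 0\<close>. Let \<open>C\<close> bound the speed on the whole manifold, let \<open>\<epsilon> \<le> e\<close> and \<open>\<alpha>\<close> be small, and take
  a rescaled \<open>(t, \<epsilon>)\<close>-spanning set \<open>F\<close>. To a periodic orbit of period \<open>p \<le> t\<close> assign a point \<open>z \<in> F\<close> whose
  ball contains a fast point \<open>x\<close> of the orbit, and the number \<open>k\<close> with \<open>k \<alpha> \<le> p < (k + 1) \<alpha>\<close>.

  This assignment is injective. If \<open>x\<close> and \<open>x'\<close>, of periods \<open>p\<close> and \<open>p'\<close>, get the same \<open>z\<close> and \<open>k\<close>, then both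
  follow the orbit of \<open>z\<close> for time \<open>t\<close>, up to \<open>\<epsilon> C\<close>; since \<open>p \<le> t\<close>, this covers a whole period. The
  linear time change \<open>s \<mapsto> (p' / p) s\<close> matches the periods, and within one period it shifts time by
  at most \<open>\<bar>p - p'\<bar> \<le> \<alpha>\<close>, which costs a distance of at most \<open>C \<alpha>\<close>. By periodicity the two orbits
  are \<open>2 \<epsilon> C + C \<alpha>\<close>-close for all times, so expansivity identifies them
  (\<open>shadowing_periodic_orbits_eq\<close>). Hence there are at most \<open>(t / \<alpha> + 1)\<close> times the cardinality of \<open>F\<close>
  periodic orbits of period at most \<open>t\<close> (\<open>num_periodic_orbits_le\<close>). The linear factor does not affect
  exponential growth rates, and the growth rate of spanning sets for one \<open>\<epsilon>\<close> is at most the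
  entropy because it increases as \<open>\<epsilon>\<close> decreases (\<open>rescaled_entropy_ge\<close>).

  The argument rests on a few geometric facts. The distance is symmetric and satisfies the triangle
  inequality (\<open>riem_dist_sym\<close>, \<open>riem_dist_triangle\<close>); the speed is continuous (\<open>speed_continuous\<close>), hence
  bounded, and bounds the distance travelled along orbits (\<open>riem_dist_orbit_le\<close>); and singularities do
  not move (\<open>Sing_fixed\<close>), so that a regular orbit never reaches one and division by the speed is
  meaningful along it.
\<close>

section \<open>Charts and tangent vectors\<close>

locale riemannian_mfd =
  fixes M :: "('a, 'e::euclidean_space) riem_mfd"
  assumes atlas: "smooth_atlas (top_of M) (atlas M)"
    and riem_metric: "riemannian_metric M"
begin

lemma chart_openin: "c \<in> atlas M \<Longrightarrow> openin (top_of M) (fst c)"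
  and chart_image_open: "c \<in> atlas M \<Longrightarrow> open (snd c ` fst c)"
  and chart_homeomorphic: "c \<in> atlas M \<Longrightarrow>
    homeomorphic_map (subtopology (top_of M) (fst c)) (top_of_set (snd c ` fst c)) (snd c)"
  using atlas unfolding smooth_atlas_def by (cases c; force)+

lemma chart_subset: "c \<in> atlas M \<Longrightarrow> fst c \<subseteq> points M"
  using chart_openin openin_subset by blast

lemma chart_exists: "p \<in> points M \<Longrightarrow> \<exists>c\<in>atlas M. p \<in> fst c"
  using atlas unfolding smooth_atlas_def by blast

lemma chart_topspace: "c \<in> atlas M \<Longrightarrow> topspace (subtopology (top_of M) (fst c)) = fst c"
  using chart_subset[of c] by auto

lemma chart_inj: "c \<in> atlas M \<Longrightarrow> inj_on (snd c) (fst c)"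
  using homeomorphic_imp_injective_map[OF chart_homeomorphic] chart_topspace by metis

lemma chart_inv_chart [simp]: "c \<in> atlas M \<Longrightarrow> p \<in> fst c \<Longrightarrow> chart_inv c (snd c p) = p"
  by (simp add: chart_inv_def chart_inj)

lemma chart_chart_inv: "z \<in> snd c ` fst c \<Longrightarrow> snd c (chart_inv c z) = z"
  and chart_inv_in: "z \<in> snd c ` fst c \<Longrightarrow> chart_inv c z \<in> fst c"
  by (auto simp: chart_inv_def f_inv_into_f inv_into_into)

lemma chart_continuous:
  "c \<in> atlas M \<Longrightarrow> continuous_map (subtopology (top_of M) (fst c)) euclidean (snd c)"
  using homeomorphic_imp_continuous_map[OF chart_homeomorphic] continuous_map_in_subtopology
  by blast

lemma chart_ball_openin:
  assumes "c \<in> atlas M" shows "openin (top_of M) {p \<in> fst c. snd c p \<in> ball z r}"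
proof -
  have "openin (subtopology (top_of M) (fst c))
      {p \<in> topspace (subtopology (top_of M) (fst c)). snd c p \<in> ball z r}"
    by (rule openin_continuous_map_preimage[OF chart_continuous[OF assms]]) auto
  then show ?thesis
    using chart_topspace[OF assms] openin_trans_full chart_openin[OF assms] by metis
qed

lemma chart_image_openin:
  assumes "c \<in> atlas M" "openin (top_of M) W" "W \<subseteq> fst c"
  shows "open (snd c ` W)"
proof -
  have "openin (subtopology (top_of M) (fst c)) W"
    using assms by (meson openin_subset_topspace_eq openin_subtopology_alt openin_imp_subset openin_open_subtopology chart_openin)
  then have "openin (top_of_set (snd c ` fst c)) (snd c ` W)"
    using homeomorphic_imp_open_map[OF chart_homeomorphic[OF assms(1)]] by (simp add: open_map_def)
  then show ?thesis using chart_image_open[OF assms(1)] openin_open_trans by blast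
qed

lemma chart_inv_continuous:
  assumes "c \<in> atlas M"
  shows "continuous_map (top_of_set (snd c ` fst c)) (top_of M) (chart_inv c)"
  unfolding continuous_map_def
proof (intro conjI allI impI funcsetI)
  fix x assume "x \<in> topspace (top_of_set (snd c ` fst c))"
  then show "chart_inv c x \<in> points M" using chart_inv_in[of x c] chart_subset[OF assms] by auto
next
  fix W assume W: "openin (top_of M) W"
  have "{z \<in> topspace (top_of_set (snd c ` fst c)). chart_inv c z \<in> W} = snd c ` (fst c \<inter> W)"
    using assms by (force simp: chart_chart_inv)
  moreover have "open (snd c ` (fst c \<inter> W))"
    by (rule chart_image_openin) (use assms W chart_openin[OF assms] in auto)
  moreover have "snd c ` (fst c \<inter> W) \<subseteq> snd c ` fst c" by blast
  ultimately show "openin (top_of_set (snd c ` fst c))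
      {z \<in> topspace (top_of_set (snd c ` fst c)). chart_inv c z \<in> W}"
    by (simp add: open_openin_trans chart_image_open[OF assms])
qed

lemma overlap_open: "c \<in> atlas M \<Longrightarrow> c' \<in> atlas M \<Longrightarrow> open (snd c ` (fst c \<inter> fst c'))"
  by (rule chart_image_openin) (auto intro: chart_openin)

lemma transition_C1:
  assumes "c \<in> atlas M" "c' \<in> atlas M"
  shows "Ck_on 1 (snd c ` (fst c \<inter> fst c')) (snd c' \<circ> chart_inv c)"
  using atlas assms unfolding smooth_atlas_def smooth_on_def by blast

lemma transition_has_derivative:
  assumes "c \<in> atlas M" "c' \<in> atlas M" "p \<in> fst c \<inter> fst c'"
  shows "((snd c' \<circ> chart_inv c) has_derivative transition_deriv c c' p) (at (snd c p))"
  using transition_C1[OF assms(1,2)] assms(3)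
  by (auto simp: transition_deriv_def frechet_derivative_works)

lemma transition_deriv_linear:
  assumes "c \<in> atlas M" "c' \<in> atlas M" "p \<in> fst c \<inter> fst c'"
  shows "linear (transition_deriv c c' p)"
  using transition_has_derivative[OF assms] has_derivative_linear by blast

text \<open>
  The cocycle identity is the chain rule for \<open>\<kappa>'' \<circ> \<kappa>\<inverse> = (\<kappa>'' \<circ> \<kappa>'\<inverse>) \<circ> (\<kappa>' \<circ> \<kappa>\<inverse>)\<close>. Because of it, a vector in
  one chart extends to a compatible family of coordinate vectors, that is, to a tangent vector.
\<close>

lemma transition_deriv_trans:
  assumes "c \<in> atlas M" "c' \<in> atlas M" "c'' \<in> atlas M" "p \<in> fst c \<inter> fst c' \<inter> fst c''"
  shows "transition_deriv c c'' p w = transition_deriv c' c'' p (transition_deriv c c' p w)"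
proof -
  have "((snd c' \<circ> chart_inv c) has_derivative transition_deriv c c' p) (at (snd c p))"
    by (rule transition_has_derivative) (use assms in auto)
  moreover have "((snd c'' \<circ> chart_inv c') has_derivative transition_deriv c' c'' p)
      (at ((snd c' \<circ> chart_inv c) (snd c p)))"
    using transition_has_derivative[of c' c'' p] assms by auto
  ultimately have "((snd c'' \<circ> chart_inv c') \<circ> (snd c' \<circ> chart_inv c) has_derivative
      transition_deriv c' c'' p \<circ> transition_deriv c c' p) (at (snd c p))"
    by (rule diff_chain_at)
  moreover have "open (snd c ` (fst c \<inter> fst c'))" using assms overlap_open by blast
  ultimately have "(snd c'' \<circ> chart_inv c has_derivative
      transition_deriv c' c'' p \<circ> transition_deriv c c' p) (at (snd c p))"
    by (rule has_derivative_transform_within_open) (use assms in auto)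
  moreover have "(snd c'' \<circ> chart_inv c has_derivative transition_deriv c c'' p) (at (snd c p))"
    by (rule transition_has_derivative) (use assms in auto)
  ultimately show ?thesis by (metis comp_apply has_derivative_unique)
qed

lemma tvec_of_tangent:
  assumes "c \<in> atlas M" "p \<in> fst c"
  shows "tvec_of M c p w \<in> tangent_space M p"
  unfolding tangent_space_def
proof (intro CollectI conjI ballI impI allI)
  fix c' c'' assume *: "c' \<in> atlas M" "c'' \<in> atlas M" "p \<in> fst c' \<inter> fst c''"
  then show "tvec_of M c p w c'' = transition_deriv c' c'' p (tvec_of M c p w c')"
    using transition_deriv_trans[of c c' c'' p w] assms by (simp add: tvec_of_def)
qed (auto simp: tvec_of_def)

lemma tangent_eq_tvec_of:
  assumes "c \<in> atlas M" "p \<in> fst c" "v \<in> tangent_space M p"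
  shows "v = tvec_of M c p (v c)"
proof
  fix c' show "v c' = tvec_of M c p (v c) c'"
  proof (cases "c' \<in> atlas M \<and> p \<in> fst c'")
    case True
    then have "v c' = transition_deriv c c' p (v c)"
      using assms unfolding tangent_space_def by blast
    with True show ?thesis by (simp add: tvec_of_def)
  next
    case False
    then have "v c' = 0" using assms(3) unfolding tangent_space_def by blast
    with False show ?thesis by (auto simp: tvec_of_def)
  qed
qed

lemma zero_tangent: "(\<lambda>c. 0) \<in> tangent_space M p"
  using linear_0[OF transition_deriv_linear] by (simp add: tangent_space_def)

section \<open>The metric and the speed of a vector field\<close>

lemma metric_linear:
  assumes "p \<in> points M" "u \<in> tangent_space M p" "v \<in> tangent_space M p" "w \<in> tangent_space M p"
  shows "metric M p (\<lambda>c. r *\<^sub>R u c + v c) w = r * metric M p u w + metric M p v w"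
  using riem_metric assms unfolding riemannian_metric_def by blast

lemma metric_sym:
  assumes "p \<in> points M" "u \<in> tangent_space M p" "v \<in> tangent_space M p"
  shows "metric M p u v = metric M p v u"
  using riem_metric assms unfolding riemannian_metric_def by blast

lemma metric_pos:
  assumes "p \<in> points M" "u \<in> tangent_space M p" "u \<noteq> (\<lambda>c. 0)"
  shows "metric M p u u > 0"
  using riem_metric assms unfolding riemannian_metric_def by blast

lemma metric_0:
  assumes "p \<in> points M" "w \<in> tangent_space M p"
  shows "metric M p (\<lambda>c. 0) w = 0"
  using metric_linear[OF assms(1) zero_tangent zero_tangent assms(2), of 1] by simp

lemma tnorm_nonneg:
  assumes "p \<in> points M" "u \<in> tangent_space M p"
  shows "tnorm M p u \<ge> 0"
  using metric_pos[OF assms] metric_0[OF assms(1) zero_tangent]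
  unfolding tnorm_def by (cases "u = (\<lambda>c. 0)") auto

lemma tnorm_pos:
  "p \<in> points M \<Longrightarrow> u \<in> tangent_space M p \<Longrightarrow> u \<noteq> (\<lambda>c. 0) \<Longrightarrow> tnorm M p u > 0"
  using metric_pos unfolding tnorm_def by simp

lemma tnorm_uminus:
  assumes p: "p \<in> points M" and u: "u \<in> tangent_space M p" and u': "(\<lambda>c. - u c) \<in> tangent_space M p"
  shows "tnorm M p (\<lambda>c. - u c) = tnorm M p u"
proof -
  have *: "metric M p (\<lambda>c. - u c) w = - metric M p u w" if "w \<in> tangent_space M p" for w
    using metric_linear[OF p u zero_tangent that, of "-1"] metric_0[OF p that] by simp
  show ?thesis
    using *[OF u'] *[OF u] metric_sym[OF p u u'] by (simp add: tnorm_def)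
qed

lemma tvec_of_linear:
  assumes "c \<in> atlas M" "p \<in> fst c"
  shows "tvec_of M c p (r *\<^sub>R v + w) = (\<lambda>c'. r *\<^sub>R tvec_of M c p v c' + tvec_of M c p w c')"
proof
  fix c' show "tvec_of M c p (r *\<^sub>R v + w) c' = r *\<^sub>R tvec_of M c p v c' + tvec_of M c p w c'"
    using assms linear_add[OF transition_deriv_linear[of c c' p]]
      linear_scale[OF transition_deriv_linear[of c c' p]]
    by (simp add: tvec_of_def)
qed

lemma metric_tvec_of_linear:
  assumes c: "c \<in> atlas M" "p \<in> fst c" and u: "u \<in> tangent_space M p"
  shows "linear (\<lambda>w. metric M p (tvec_of M c p w) u)"
proof -
  have p: "p \<in> points M" using c chart_subset by blast
  have *: "metric M p (tvec_of M c p (r *\<^sub>R v + w)) u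
      = r * metric M p (tvec_of M c p v) u + metric M p (tvec_of M c p w) u" for r v w
    unfolding tvec_of_linear[OF c] using metric_linear[OF p] tvec_of_tangent[OF c] u by blast
  from *[of 1 0 0] have 0: "metric M p (tvec_of M c p 0) u = 0" by simp
  show ?thesis
  proof (rule linearI)
    show "metric M p (tvec_of M c p (v + w)) u
      = metric M p (tvec_of M c p v) u + metric M p (tvec_of M c p w) u" for v w
      using *[of 1 v w] by simp
    show "metric M p (tvec_of M c p (r *\<^sub>R v)) u = r *\<^sub>R metric M p (tvec_of M c p v) u" for r v
      using *[of r v 0] 0 by simp
  qed
qed

text \<open>
  Expressing the metric through its coefficients in a chart, which are smooth there, is what gives
  continuity of the speed of a vector field.
\<close>

lemma metric_in_chart:
  assumes c: "c \<in> atlas M" "p \<in> fst c" and u: "u \<in> tangent_space M p"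
  shows "metric M p u u = (\<Sum>i\<in>Basis. \<Sum>j\<in>Basis. (u c \<bullet> i) * (u c \<bullet> j) *
           metric M p (tvec_of M c p i) (tvec_of M c p j))"
proof -
  have p: "p \<in> points M" using c chart_subset by blast
  define T where "T = tvec_of M c p"
  note T = tvec_of_tangent[OF c, folded T_def]
  define w where "w = u c"
  have u_eq: "u = T w" using tangent_eq_tvec_of[OF c u] by (simp add: T_def w_def)
  have expand: "metric M p (T x) v = (\<Sum>i\<in>Basis. (x \<bullet> i) * metric M p (T i) v)"
    if "v \<in> tangent_space M p" for v x
  proof -
    note L = metric_tvec_of_linear[OF c that, folded T_def]
    have "metric M p (T x) v = metric M p (T (\<Sum>i\<in>Basis. (x \<bullet> i) *\<^sub>R i)) v"
      by (simp add: euclidean_representation)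
    also have "\<dots> = (\<Sum>i\<in>Basis. (x \<bullet> i) * metric M p (T i) v)"
      using linear_sum[OF L, of "\<lambda>i. (x \<bullet> i) *\<^sub>R i" Basis] linear_scale[OF L] by simp
    finally show ?thesis .
  qed
  have "metric M p (T w) (T w) = (\<Sum>i\<in>Basis. (w \<bullet> i) * metric M p (T i) (T w))"
    by (rule expand[OF T])
  also have "\<dots> = (\<Sum>i\<in>Basis. (w \<bullet> i) * (\<Sum>j\<in>Basis. (w \<bullet> j) * metric M p (T j) (T i)))"
    by (intro sum.cong refl) (metis expand T metric_sym[OF p])
  also have "\<dots> = (\<Sum>i\<in>Basis. \<Sum>j\<in>Basis. (w \<bullet> i) * (w \<bullet> j) * metric M p (T i) (T j))"
    unfolding sum_distrib_left
    by (intro sum.cong refl) (simp add: metric_sym[OF p T T])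
  finally have "metric M p u u
      = (\<Sum>i\<in>Basis. \<Sum>j\<in>Basis. (w \<bullet> i) * (w \<bullet> j) * metric M p (T i) (T j))"
    by (simp only: u_eq)
  then show ?thesis by (simp only: T_def w_def)
qed

lemma continuous_map_charts:
  assumes "\<And>c. c \<in> atlas M \<Longrightarrow> continuous_on (snd c ` fst c) (\<lambda>z. f (chart_inv c z))"
  shows "continuous_map (top_of M) euclidean (f :: 'a \<Rightarrow> 'b::topological_space)"
proof (rule pasting_lemma[where I = "atlas M" and T = fst and f = "\<lambda>_. f"])
  fix c assume c: "c \<in> atlas M"
  show "openin (top_of M) (fst c)" using c by (rule chart_openin)
  have "continuous_map (top_of_set (snd c ` fst c)) euclidean (\<lambda>z. f (chart_inv c z))"
    using assms[OF c] by simp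
  then have "continuous_map (subtopology (top_of M) (fst c)) euclidean ((\<lambda>z. f (chart_inv c z)) \<circ> snd c)"
    using homeomorphic_imp_continuous_map[OF chart_homeomorphic[OF c]] continuous_map_compose by blast
  then show "continuous_map (subtopology (top_of M) (fst c)) euclidean f"
    by (rule continuous_map_eq) (use c in \<open>auto simp: chart_topspace\<close>)
next
  show "\<And>x. x \<in> points M \<Longrightarrow> \<exists>j. j \<in> atlas M \<and> x \<in> fst j \<and> f x = f x"
    using chart_exists by blast
qed auto

lemma speed_continuous:
  assumes "C1_vector_field M X"
  shows "continuous_map (top_of M) euclideanreal (\<lambda>p. tnorm M p (X p))"
proof (rule continuous_map_charts)
  fix c assume c: "c \<in> atlas M"
  let ?q = "chart_inv c"
  let ?g = "\<lambda>v w z. metric M (?q z) (tvec_of M c (?q z) v) (tvec_of M c (?q z) w)"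
  have X: "continuous_on (snd c ` fst c) (\<lambda>z. X (?q z) c)"
    using assms c by (auto simp: C1_vector_field_def intro!: continuous_at_imp_continuous_on
        differentiable_imp_continuous_within)
  have g: "continuous_on (snd c ` fst c) (?g v w)" for v w
  proof -
    have "smooth_on (snd c ` fst c) (?g v w)" using riem_metric c unfolding riemannian_metric_def by blast
    then have "Ck_on 0 (snd c ` fst c) (?g v w)" unfolding smooth_on_def by blast
    then show ?thesis by simp
  qed
  have "continuous_on (snd c ` fst c) (\<lambda>z. sqrt (\<Sum>i\<in>Basis. \<Sum>j\<in>Basis.
      (X (?q z) c \<bullet> i) * (X (?q z) c \<bullet> j) * ?g i j z))"
    by (intro continuous_intros X g)
  then show "continuous_on (snd c ` fst c) (\<lambda>z. tnorm M (?q z) (X (?q z)))"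
  proof (rule continuous_on_eq)
    fix z assume "z \<in> snd c ` fst c"
    then have z: "?q z \<in> fst c" by (rule chart_inv_in)
    then have "X (?q z) \<in> tangent_space M (?q z)"
      using assms c chart_subset unfolding C1_vector_field_def by blast
    then show "sqrt (\<Sum>i\<in>Basis. \<Sum>j\<in>Basis. (X (?q z) c \<bullet> i) * (X (?q z) c \<bullet> j) * ?g i j z)
        = tnorm M (?q z) (X (?q z))"
      using metric_in_chart[OF c z] by (simp add: tnorm_def)
  qed
qed


section \<open>Piecewise smooth curves and their lengths\<close>

lemma eventually_in_open:
  assumes "continuous_map (top_of_set I) T \<gamma>" "openin T U" "\<gamma> s \<in> U" "s \<in> I"
  shows "eventually (\<lambda>s'. \<gamma> s' \<in> U) (at s within I)"
proof -
  have "openin (top_of_set I) {s' \<in> I. \<gamma> s' \<in> U}"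
    using openin_continuous_map_preimage[OF assms(1,2)] by simp
  then obtain W where "open W" "{s' \<in> I. \<gamma> s' \<in> U} = I \<inter> W" unfolding openin_open by blast
  then show ?thesis using assms unfolding eventually_at_topological by blast
qed

text \<open>
  Used with \<open>I = UNIV\<close>, this shows that velocities are tangent vectors; used with \<open>I\<close>
  a closed interval, it transfers one-sided derivatives of a coordinate segment to the other charts.
\<close>

lemma chart_change_vector_derivative:
  assumes c: "c \<in> atlas M" "c' \<in> atlas M" and s: "s \<in> I" "\<gamma> s \<in> fst c \<inter> fst c'"
    and ev: "eventually (\<lambda>s'. \<gamma> s' \<in> fst c) (at s within I)"
    and D: "((snd c \<circ> \<gamma>) has_vector_derivative v) (at s within I)"
  shows "((snd c' \<circ> \<gamma>) has_vector_derivative transition_deriv c c' (\<gamma> s) v) (at s within I)"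
proof -
  let ?T = "transition_deriv c c' (\<gamma> s)"
  have "((snd c' \<circ> chart_inv c) has_derivative ?T) (at ((snd c \<circ> \<gamma>) s) within (snd c \<circ> \<gamma>) ` I)"
    using transition_has_derivative[OF c s(2)] by (simp add: has_derivative_at_withinI)
  from diff_chain_within[OF D[unfolded has_vector_derivative_def] this]
  have "((snd c' \<circ> chart_inv c) \<circ> (snd c \<circ> \<gamma>) has_derivative (\<lambda>h. h *\<^sub>R ?T v)) (at s within I)"
    using linear_scale[OF transition_deriv_linear[OF c s(2)]] by (simp add: o_def)
  then have "((snd c' \<circ> \<gamma>) has_derivative (\<lambda>h. h *\<^sub>R ?T v)) (at s within I)"
  proof (rule has_derivative_transform_eventually)
    show "\<forall>\<^sub>F s' in at s within I. ((snd c' \<circ> chart_inv c) \<circ> (snd c \<circ> \<gamma>)) s' = (snd c' \<circ> \<gamma>) s'"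
      using ev by eventually_elim (use c in simp)
  qed (use c s in auto)
  then show ?thesis by (simp add: has_vector_derivative_def)
qed

lemma C1_curve_points: "C1_curve_on M I \<gamma> \<Longrightarrow> s \<in> I \<Longrightarrow> \<gamma> s \<in> points M"
  unfolding C1_curve_on_def continuous_map_def by auto

lemma velocity_has_vector_derivative:
  assumes "C1_curve_on M I \<gamma>" "s \<in> interior I" "c \<in> atlas M" "\<gamma> s \<in> fst c"
  shows "((snd c \<circ> \<gamma>) has_vector_derivative velocity M \<gamma> s c) (at s)"
proof -
  have "s \<in> I" using assms(2) interior_subset by blast
  obtain D where "((snd c \<circ> \<gamma>) has_vector_derivative D s) (at s within I)"
    using assms \<open>s \<in> I\<close> unfolding C1_curve_on_def by (cases c) fastforce
  then have "((snd c \<circ> \<gamma>) has_vector_derivative D s) (at s)"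
    by (simp add: at_within_interior[OF assms(2)])
  then show ?thesis using assms(3,4) by (simp add: velocity_def vector_derivative_at)
qed

lemma velocity_tangent:
  assumes "C1_curve_on M I \<gamma>" "s \<in> interior I"
  shows "velocity M \<gamma> s \<in> tangent_space M (\<gamma> s)"
  unfolding tangent_space_def
proof (intro CollectI conjI ballI impI allI)
  fix c c' assume c: "c \<in> atlas M" "c' \<in> atlas M" "\<gamma> s \<in> fst c \<inter> fst c'"
  have "s \<in> I" using assms(2) interior_subset by blast
  then have "eventually (\<lambda>s'. \<gamma> s' \<in> fst c) (at s within I)"
    using assms(1) c chart_openin unfolding C1_curve_on_def
    by (intro eventually_in_open[where T = "top_of M"]) auto
  then have "eventually (\<lambda>s'. \<gamma> s' \<in> fst c) (at s within UNIV)"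
    by (simp add: at_within_interior[OF assms(2)])
  with c velocity_has_vector_derivative[OF assms c(1)]
  have "((snd c' \<circ> \<gamma>) has_vector_derivative transition_deriv c c' (\<gamma> s) (velocity M \<gamma> s c)) (at s)"
    by (intro chart_change_vector_derivative) auto
  then show "velocity M \<gamma> s c' = transition_deriv c c' (\<gamma> s) (velocity M \<gamma> s c)"
    using velocity_has_vector_derivative[OF assms c(2)] c vector_derivative_unique_at by blast
qed (auto simp: velocity_def)

text \<open>
  Translations (\<open>m = 1\<close>) serve to join curves, the reflection (\<open>m = - 1\<close>) to reverse them.
\<close>

lemma C1_curve_on_affine:
  assumes \<gamma>: "C1_curve_on M I \<gamma>" and J: "\<And>s. s \<in> J \<Longrightarrow> m * s + k \<in> I"
  shows "C1_curve_on M J (\<lambda>s. \<gamma> (m * s + k))"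
proof -
  have "continuous_map (top_of_set J) (top_of_set I) (\<lambda>s. m * s + k)"
    using J by (auto intro!: continuous_map_into_subtopology continuous_intros)
  with \<gamma> have "continuous_map (top_of_set J) (top_of M) (\<gamma> \<circ> (\<lambda>s. m * s + k))"
    unfolding C1_curve_on_def by (blast intro: continuous_map_compose)
  moreover have "\<exists>D. continuous_on (J \<inter> (\<lambda>s. \<gamma> (m * s + k)) -` U) D \<and>
      (\<forall>s\<in>J \<inter> (\<lambda>s. \<gamma> (m * s + k)) -` U.
         ((\<kappa> \<circ> (\<lambda>s. \<gamma> (m * s + k))) has_vector_derivative D s) (at s within J))"
    if c: "(U, \<kappa>) \<in> atlas M" for U \<kappa>
  proof -
    obtain D where D: "continuous_on (I \<inter> \<gamma> -` U) D"
      "\<And>s. s \<in> I \<inter> \<gamma> -` U \<Longrightarrow> ((\<kappa> \<circ> \<gamma>) has_vector_derivative D s) (at s within I)"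
      using \<gamma> c unfolding C1_curve_on_def by blast
    have "continuous_on (J \<inter> (\<lambda>s. \<gamma> (m * s + k)) -` U) (\<lambda>s. m *\<^sub>R D (m * s + k))"
      by (intro continuous_intros continuous_on_compose2[OF D(1)]) (use J in auto)
    moreover have "((\<kappa> \<circ> (\<lambda>s. \<gamma> (m * s + k))) has_vector_derivative m *\<^sub>R D (m * s + k)) (at s within J)"
      if s: "s \<in> J \<inter> (\<lambda>s. \<gamma> (m * s + k)) -` U" for s
    proof -
      have "((\<lambda>s. m * s + k) has_vector_derivative m) (at s within J)"
        by (auto intro!: derivative_eq_intros)
      moreover have "((\<kappa> \<circ> \<gamma>) has_vector_derivative D (m * s + k))
          (at (m * s + k) within (\<lambda>s. m * s + k) ` J)"
        by (rule has_vector_derivative_within_subset[OF D(2)]) (use s J in auto)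
      ultimately show ?thesis
        by (drule_tac vector_diff_chain_within) (auto simp: o_def)
    qed
    ultimately show ?thesis by (intro exI[of _ "\<lambda>s. m *\<^sub>R D (m * s + k)"]) blast
  qed
  ultimately show ?thesis unfolding C1_curve_on_def by (auto simp: o_def)
qed

lemma velocity_affine:
  assumes "C1_curve_on M I \<gamma>" "m * s + k \<in> interior I"
  shows "velocity M (\<lambda>s. \<gamma> (m * s + k)) s = (\<lambda>c. m *\<^sub>R velocity M \<gamma> (m * s + k) c)"
proof
  fix c
  show "velocity M (\<lambda>s. \<gamma> (m * s + k)) s c = m *\<^sub>R velocity M \<gamma> (m * s + k) c"
  proof (cases "c \<in> atlas M \<and> \<gamma> (m * s + k) \<in> fst c")
    case True
    have "((\<lambda>s. m * s + k) has_vector_derivative m) (at s)"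
      by (auto intro!: derivative_eq_intros)
    from vector_diff_chain_at[OF this velocity_has_vector_derivative[OF assms, of c]] True
    show ?thesis
      unfolding velocity_def[of M "\<lambda>s. \<gamma> (m * s + k)"]
      by (simp add: o_def vector_derivative_at del: split_paired_All)
  qed (auto simp: velocity_def)
qed

lemma C1_curve_on_cong:
  assumes "C1_curve_on M I \<gamma>" "\<And>s. s \<in> I \<Longrightarrow> \<gamma> s = \<gamma>' s"
  shows "C1_curve_on M I \<gamma>'"
proof -
  have "continuous_map (top_of_set I) (top_of M) \<gamma>'"
    by (rule continuous_map_eq[where f = \<gamma>]) (use assms in \<open>auto simp: C1_curve_on_def\<close>)
  moreover have "\<exists>D. continuous_on (I \<inter> \<gamma>' -` U) D \<and>
      (\<forall>s\<in>I \<inter> \<gamma>' -` U. ((\<kappa> \<circ> \<gamma>') has_vector_derivative D s) (at s within I))"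
    if c: "(U, \<kappa>) \<in> atlas M" for U \<kappa>
  proof -
    have I: "I \<inter> \<gamma>' -` U = I \<inter> \<gamma> -` U" using assms(2) by auto
    obtain D where "continuous_on (I \<inter> \<gamma> -` U) D"
      "\<And>s. s \<in> I \<inter> \<gamma> -` U \<Longrightarrow> ((\<kappa> \<circ> \<gamma>) has_vector_derivative D s) (at s within I)"
      using assms(1) c unfolding C1_curve_on_def by blast
    then show ?thesis unfolding I
      by (intro exI[of _ D] conjI ballI has_vector_derivative_transform[of _ I "\<kappa> \<circ> \<gamma>'" "\<kappa> \<circ> \<gamma>"])
        (use assms(2) in auto)
  qed
  ultimately show ?thesis unfolding C1_curve_on_def by blast
qed

lemma velocity_cong:
  fixes \<gamma> \<gamma>' :: "real \<Rightarrow> 'a"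
  assumes "eventually (\<lambda>s'. \<gamma> s' = \<gamma>' s') (nhds s)"
  shows "velocity M \<gamma> s = velocity M \<gamma>' s"
proof
  fix c :: "('a, 'e) chart"
  have "eventually (\<lambda>s'. s' \<in> UNIV \<longrightarrow> (snd c \<circ> \<gamma>) s' = (snd c \<circ> \<gamma>') s') (nhds s)"
    using assms by eventually_elim simp
  then have "vector_derivative (snd c \<circ> \<gamma>) (at s) = vector_derivative (snd c \<circ> \<gamma>') (at s)"
    by (rule vector_derivative_cong_eq) auto
  moreover have "\<gamma> s = \<gamma>' s" using assms eventually_nhds_x_imp_x by blast
  ultimately show "velocity M \<gamma> s c = velocity M \<gamma>' s c" by (simp add: velocity_def)
qed

lemma piecewise_C1_subdivision:
  assumes "piecewise_C1_curve M a b \<gamma>"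
  obtains S where "finite S" "a \<in> S" "b \<in> S" "S \<subseteq> {a..b}"
    "\<And>s t. s \<in> S \<Longrightarrow> t \<in> S \<Longrightarrow> s < t \<Longrightarrow> {s<..<t} \<inter> S = {} \<Longrightarrow> C1_curve_on M {s..t} \<gamma>"
proof -
  have "\<exists>S. finite S \<and> {a, b} \<subseteq> S \<and> S \<subseteq> {a..b} \<and>
      (\<forall>s\<in>S. \<forall>t\<in>S. s < t \<and> {s<..<t} \<inter> S = {} \<longrightarrow> C1_curve_on M {s..t} \<gamma>)"
    using assms unfolding piecewise_C1_curve_def by (rule conjunct2)
  then obtain S where "finite S \<and> {a, b} \<subseteq> S \<and> S \<subseteq> {a..b} \<and>
      (\<forall>s\<in>S. \<forall>t\<in>S. s < t \<and> {s<..<t} \<inter> S = {} \<longrightarrow> C1_curve_on M {s..t} \<gamma>)"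
    by (rule exE)
  then show ?thesis by (intro that[of S]) simp_all
qed

text \<open>
  A point off the subdivision lies between its two neighbours in the subdivision, where the curve is
  \<open>C\<^sup>1\<close>.
\<close>

lemma piecewise_C1_regular:
  assumes "piecewise_C1_curve M a b \<gamma>"
  obtains S where "finite S" "\<And>s. s \<in> {a..b} - S \<Longrightarrow> \<exists>I. C1_curve_on M I \<gamma> \<and> s \<in> interior I"
proof -
  obtain S where fin: "finite S" and ab: "a \<in> S" "b \<in> S" "S \<subseteq> {a..b}"
    and C1: "\<And>s t. s \<in> S \<Longrightarrow> t \<in> S \<Longrightarrow> s < t \<Longrightarrow> {s<..<t} \<inter> S = {} \<Longrightarrow> C1_curve_on M {s..t} \<gamma>"
    using piecewise_C1_subdivision[OF assms] by metis
  have "\<exists>I. C1_curve_on M I \<gamma> \<and> s \<in> interior I" if s: "s \<in> {a..b} - S" for s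
  proof -
    let ?L = "{x\<in>S. x < s}" and ?R = "{x\<in>S. s < x}"
    have "a \<in> ?L" "b \<in> ?R" using ab s by (auto simp: less_le)
    then have "Max ?L \<in> ?L" "Min ?R \<in> ?R" using fin by (intro Max_in Min_in; auto)+
    moreover have "{Max ?L<..<Min ?R} \<inter> S = {}"
    proof (rule equals0I)
      fix x assume x: "x \<in> {Max ?L<..<Min ?R} \<inter> S"
      then have "x \<noteq> s" using s by blast
      then have "x < s \<or> s < x" by linarith
      moreover have "\<not> x < s" using x fin Max_ge[of ?L x] by fastforce
      moreover have "\<not> s < x" using x fin Min_le[of ?R x] by fastforce
      ultimately show False by blast
    qed
    ultimately have "C1_curve_on M {Max ?L..Min ?R} \<gamma>"
      by (intro C1) auto
    moreover have "s \<in> interior {Max ?L..Min ?R}"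
      using \<open>Max ?L \<in> ?L\<close> \<open>Min ?R \<in> ?R\<close> by simp
    ultimately have "C1_curve_on M {Max ?L..Min ?R} \<gamma>" "s \<in> interior {Max ?L..Min ?R}" .
    then show ?thesis by blast
  qed
  with fin show ?thesis using that by blast
qed

lemma piecewise_C1_tangent:
  assumes "piecewise_C1_curve M a b \<gamma>"
  obtains S where "finite S" "\<And>s. s \<in> {a..b} - S \<Longrightarrow> \<gamma> s \<in> points M"
    "\<And>s. s \<in> {a..b} - S \<Longrightarrow> velocity M \<gamma> s \<in> tangent_space M (\<gamma> s)"
proof -
  obtain S where S: "finite S" "\<And>s. s \<in> {a..b} - S \<Longrightarrow> \<exists>I. C1_curve_on M I \<gamma> \<and> s \<in> interior I"
    using piecewise_C1_regular[OF assms] by blast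
  have "\<gamma> s \<in> points M \<and> velocity M \<gamma> s \<in> tangent_space M (\<gamma> s)" if s: "s \<in> {a..b} - S" for s
  proof -
    obtain I where I: "C1_curve_on M I \<gamma>" "s \<in> interior I" using S(2)[OF s] by blast
    then have "s \<in> I" using interior_subset by blast
    with I show ?thesis using C1_curve_points velocity_tangent by blast
  qed
  with S(1) show ?thesis using that by blast
qed

text \<open>
  Since \<open>tnorm\<close> is a square root that is odd on negative numbers, the integrand could be negative
  where the velocity is not tangent. This can only happen at finitely many points.
\<close>

lemma curve_length_nonneg:
  assumes "piecewise_C1_curve M a b \<gamma>"
  shows "curve_length M a b \<gamma> \<ge> 0"
proof -
  let ?f = "\<lambda>s. tnorm M (\<gamma> s) (velocity M \<gamma> s)"
  obtain S where S: "finite S" "\<And>s. s \<in> {a..b} - S \<Longrightarrow> \<gamma> s \<in> points M"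
    "\<And>s. s \<in> {a..b} - S \<Longrightarrow> velocity M \<gamma> s \<in> tangent_space M (\<gamma> s)"
    using piecewise_C1_tangent[OF assms] by blast
  have "integral {a..b} ?f = integral {a..b} (\<lambda>s. if s \<in> S then 0 else ?f s)"
    by (rule integral_spike[of S]) (use S in \<open>auto simp: negligible_finite\<close>)
  also have "\<dots> \<ge> 0"
  proof (cases "(\<lambda>s. if s \<in> S then 0 else ?f s) integrable_on {a..b}")
    case True
    then show ?thesis by (rule integral_nonneg) (use S tnorm_nonneg in auto)
  qed (simp add: not_integrable_integral)
  finally show ?thesis by (simp add: curve_length_def)
qed


lemma uminus_tangent:
  assumes "u \<in> tangent_space M p" shows "(\<lambda>c. - u c) \<in> tangent_space M p"
  unfolding tangent_space_def
proof (intro CollectI conjI ballI impI allI)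
  fix c c' assume c: "c \<in> atlas M" "c' \<in> atlas M" "p \<in> fst c \<inter> fst c'"
  then have "u c' = transition_deriv c c' p (u c)" using assms unfolding tangent_space_def by blast
  then show "- u c' = transition_deriv c c' p (- u c)"
    using linear_neg[OF transition_deriv_linear[OF c]] by simp
next
  fix c assume "\<not> (c \<in> atlas M \<and> p \<in> fst c)"
  then have "u c = 0" using assms unfolding tangent_space_def by blast
  then show "- u c = 0" by simp
qed

lemma piecewise_C1_affine:
  assumes \<gamma>: "piecewise_C1_curve M a b \<gamma>" and m: "m = 1 \<or> m = - 1" and "a' < b'"
    and ends: "{m * a' + k, m * b' + k} = {a, b}"
  shows "piecewise_C1_curve M a' b' (\<lambda>s. \<gamma> (m * s + k))"
proof -
  obtain S where fin: "finite S" and ab: "a \<in> S" "b \<in> S" "S \<subseteq> {a..b}"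
    and C1: "\<And>s t. s \<in> S \<Longrightarrow> t \<in> S \<Longrightarrow> s < t \<Longrightarrow> {s<..<t} \<inter> S = {} \<Longrightarrow> C1_curve_on M {s..t} \<gamma>"
    using piecewise_C1_subdivision[OF \<gamma>] by metis
  have "a < b" using \<gamma> by (simp add: piecewise_C1_curve_def)
  let ?g = "\<lambda>s. m * s + k"
  have eq: "(m * a' + k = a \<and> m * b' + k = b) \<or> (m * a' + k = b \<and> m * b' + k = a)"
    using ends by (simp add: doubleton_eq_iff)
  have "finite (?g -` S)"
    using fin m by (intro finite_vimageI) (auto simp: inj_on_def)
  moreover have "{a', b'} \<subseteq> ?g -` S"
    using eq ab by auto
  moreover have "?g -` S \<subseteq> {a'..b'}"
  proof
    fix s assume "s \<in> ?g -` S"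
    then have "a \<le> m * s + k" "m * s + k \<le> b" using ab(3) by auto
    then show "s \<in> {a'..b'}"
      using m eq \<open>a < b\<close> \<open>a' < b'\<close> by auto
  qed
  moreover have "C1_curve_on M {s..t} (\<lambda>s. \<gamma> (?g s))"
    if st: "s \<in> ?g -` S" "t \<in> ?g -` S" "s < t" "{s<..<t} \<inter> ?g -` S = {}" for s t
  proof -
    have gap: "x \<notin> S" if "x \<in> {?g s<..<?g t} \<union> {?g t<..<?g s}" for x
    proof
      assume "x \<in> S"
      then have "m * (x - k) \<in> ?g -` S" using m by auto
      moreover have "m * (x - k) \<in> {s<..<t}" using that m st(3) by auto
      ultimately show False using st(4) by blast
    qed
    have "\<exists>I. C1_curve_on M I \<gamma> \<and> (\<forall>x\<in>{s..t}. m * x + k \<in> I)"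
    proof (cases "m = 1")
      case True
      then have "C1_curve_on M {?g s..?g t} \<gamma>"
        using st gap by (intro C1) auto
      with True show ?thesis by (intro exI[of _ "{?g s..?g t}"]) auto
    next
      case False
      then have "m = - 1" using m by simp
      moreover from this have "C1_curve_on M {?g t..?g s} \<gamma>"
        using st gap by (intro C1) auto
      ultimately show ?thesis by (intro exI[of _ "{?g t..?g s}"]) auto
    qed
    then show ?thesis using C1_curve_on_affine by blast
  qed
  ultimately show ?thesis using \<open>a' < b'\<close> unfolding piecewise_C1_curve_def
    by (intro conjI exI[of _ "?g -` S"] ballI impI) simp_all
qed

lemma curve_length_affine:
  assumes \<gamma>: "piecewise_C1_curve M a b \<gamma>" and m: "m = 1 \<or> m = - 1"
    and sub: "\<And>s. s \<in> {a'..b'} \<Longrightarrow> m * s + k \<in> {a..b}"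
  shows "curve_length M a' b' (\<lambda>s. \<gamma> (m * s + k)) =
    integral {a'..b'} (\<lambda>s. tnorm M (\<gamma> (m * s + k)) (velocity M \<gamma> (m * s + k)))"
proof -
  obtain S where S: "finite S" "\<And>s. s \<in> {a..b} - S \<Longrightarrow> \<exists>I. C1_curve_on M I \<gamma> \<and> s \<in> interior I"
    using piecewise_C1_regular[OF \<gamma>] by blast
  have "finite ((\<lambda>s. m * s + k) -` S)"
    using S m by (intro finite_vimageI) (auto simp: inj_on_def)
  moreover have "tnorm M (\<gamma> (m * s + k)) (velocity M (\<lambda>s. \<gamma> (m * s + k)) s)
      = tnorm M (\<gamma> (m * s + k)) (velocity M \<gamma> (m * s + k))"
    if s: "s \<in> {a'..b'} - (\<lambda>s. m * s + k) -` S" for s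
  proof -
    have "m * s + k \<in> {a..b} - S" using s sub by blast
    then obtain I where I: "C1_curve_on M I \<gamma>" "m * s + k \<in> interior I" using S(2) by blast
    then have "\<gamma> (m * s + k) \<in> points M" using C1_curve_points interior_subset by blast
    then show ?thesis
      using m tnorm_uminus[OF _ velocity_tangent[OF I] uminus_tangent[OF velocity_tangent[OF I]]]
      unfolding velocity_affine[OF I] by (elim disjE) simp_all
  qed
  ultimately show ?thesis unfolding curve_length_def
    by (intro integral_spike[of "(\<lambda>s. m * s + k) -` S"]) (auto simp: negligible_finite)
qed

lemma piecewise_C1_join:
  assumes \<gamma>: "piecewise_C1_curve M a b \<gamma>" and \<delta>: "piecewise_C1_curve M b d \<delta>" and eq: "\<gamma> b = \<delta> b"
  shows "piecewise_C1_curve M a d (\<lambda>s. if s \<le> b then \<gamma> s else \<delta> s)"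
proof -
  obtain S where S: "finite S" "a \<in> S" "b \<in> S" "S \<subseteq> {a..b}"
    and C1S: "\<And>s t. s \<in> S \<Longrightarrow> t \<in> S \<Longrightarrow> s < t \<Longrightarrow> {s<..<t} \<inter> S = {} \<Longrightarrow> C1_curve_on M {s..t} \<gamma>"
    using piecewise_C1_subdivision[OF \<gamma>] by metis
  obtain T where T: "finite T" "b \<in> T" "d \<in> T" "T \<subseteq> {b..d}"
    and C1T: "\<And>s t. s \<in> T \<Longrightarrow> t \<in> T \<Longrightarrow> s < t \<Longrightarrow> {s<..<t} \<inter> T = {} \<Longrightarrow> C1_curve_on M {s..t} \<delta>"
    using piecewise_C1_subdivision[OF \<delta>] by metis
  have S_le: "\<And>s. s \<in> S \<Longrightarrow> s \<le> b" and T_ge: "\<And>s. s \<in> T \<Longrightarrow> b \<le> s" using S T by auto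
  have ab: "a < b" "b < d" using \<gamma> \<delta> by (auto simp: piecewise_C1_curve_def)
  have "C1_curve_on M {s..t} (\<lambda>s. if s \<le> b then \<gamma> s else \<delta> s)"
    if st: "s \<in> S \<union> T" "t \<in> S \<union> T" "s < t" "{s<..<t} \<inter> (S \<union> T) = {}" for s t
  proof (cases "t \<le> b")
    case True
    have "s \<in> S" using st True T_ge[of s] by auto
    moreover have "t \<in> S" using st(2) True T_ge[of t] S(3) by (cases "t = b") auto
    ultimately have "C1_curve_on M {s..t} \<gamma>" using st by (intro C1S) auto
    then show ?thesis by (rule C1_curve_on_cong) (use True in auto)
  next
    case False
    have "b \<le> s"
    proof (rule ccontr)
      assume "\<not> b \<le> s"
      then have "b \<in> {s<..<t} \<inter> (S \<union> T)" using False S(3) by auto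
      then show False using st(4) by blast
    qed
    have "t \<in> T" using st False S_le[of t] by auto
    moreover have "s \<in> T" using st(1) \<open>b \<le> s\<close> S_le[of s] T(2) by (cases "s = b") auto
    ultimately have "C1_curve_on M {s..t} \<delta>" using st by (intro C1T) auto
    then show ?thesis
    proof (rule C1_curve_on_cong)
      fix x assume "x \<in> {s..t}"
      then show "\<delta> x = (if x \<le> b then \<gamma> x else \<delta> x)"
        using \<open>b \<le> s\<close> eq by (cases "x = b") auto
    qed
  qed
  moreover have "finite (S \<union> T)" "{a, d} \<subseteq> S \<union> T" "S \<union> T \<subseteq> {a..d}" using S T ab by auto
  ultimately show ?thesis using ab unfolding piecewise_C1_curve_def
    by (intro conjI exI[of _ "S \<union> T"] ballI impI) (simp_all del: Un_iff)
qed

text \<open>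
  If the speed of the joined curve is integrable, then so are its restrictions and the lengths add
  up. If it is not, its length is \<open>0\<close> by the convention for the integral, and the inequality
  reduces to nonnegativity of lengths.
\<close>

lemma curve_length_join_le:
  assumes \<gamma>: "piecewise_C1_curve M a b \<gamma>" and \<delta>: "piecewise_C1_curve M b d \<delta>"
  shows "curve_length M a d (\<lambda>s. if s \<le> b then \<gamma> s else \<delta> s)
    \<le> curve_length M a b \<gamma> + curve_length M b d \<delta>"
proof -
  let ?\<beta> = "\<lambda>s. if s \<le> b then \<gamma> s else \<delta> s"
  let ?f = "\<lambda>s. tnorm M (?\<beta> s) (velocity M ?\<beta> s)"
  have ab: "a < b" "b < d" using \<gamma> \<delta> by (auto simp: piecewise_C1_curve_def)
  have \<gamma>_eq: "integral {a..b} ?f = curve_length M a b \<gamma>" unfolding curve_length_def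
  proof (rule integral_spike[of "{b}"])
    fix s assume "s \<in> {a..b} - {b}"
    then have "s \<in> {..<b}" by auto
    then have "eventually (\<lambda>s'. s' \<in> {..<b}) (nhds s)" by (intro eventually_nhds_in_open) auto
    then have "eventually (\<lambda>s'. ?\<beta> s' = \<gamma> s') (nhds s)" by eventually_elim auto
    then have "velocity M ?\<beta> s = velocity M \<gamma> s" by (rule velocity_cong)
    with \<open>s \<in> {..<b}\<close> show "tnorm M (\<gamma> s) (velocity M \<gamma> s) = ?f s" by auto
  qed auto
  have \<delta>_eq: "integral {b..d} ?f = curve_length M b d \<delta>" unfolding curve_length_def
  proof (rule integral_spike[of "{b}"])
    fix s assume "s \<in> {b..d} - {b}"
    then have "s \<in> {b<..}" by auto
    then have "eventually (\<lambda>s'. s' \<in> {b<..}) (nhds s)" by (intro eventually_nhds_in_open) auto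
    then have "eventually (\<lambda>s'. ?\<beta> s' = \<delta> s') (nhds s)" by eventually_elim auto
    then have "velocity M ?\<beta> s = velocity M \<delta> s" by (rule velocity_cong)
    with \<open>s \<in> {b<..}\<close> show "tnorm M (\<delta> s) (velocity M \<delta> s) = ?f s" by auto
  qed auto
  show ?thesis
  proof (cases "?f integrable_on {a..d}")
    case True
    then have "integral {a..b} ?f + integral {b..d} ?f = integral {a..d} ?f"
      using ab by (intro Henstock_Kurzweil_Integration.integral_combine) auto
    then show ?thesis using \<gamma>_eq \<delta>_eq by (simp add: curve_length_def)
  next
    case False
    then have "curve_length M a d ?\<beta> = 0"
      by (simp add: curve_length_def not_integrable_integral)
    then show ?thesis using curve_length_nonneg[OF \<gamma>] curve_length_nonneg[OF \<delta>] by simp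
  qed
qed

section \<open>The Riemannian distance\<close>

definition joining_lengths :: "'a \<Rightarrow> 'a \<Rightarrow> real set" where
  "joining_lengths x y =
     {curve_length M a b \<gamma> | a b \<gamma>. piecewise_C1_curve M a b \<gamma> \<and> \<gamma> a = x \<and> \<gamma> b = y}"

lemma joining_lengthsI:
  "piecewise_C1_curve M a b \<gamma> \<Longrightarrow> curve_length M a b \<gamma> \<in> joining_lengths (\<gamma> a) (\<gamma> b)"
  unfolding joining_lengths_def by blast

lemma joining_lengths_nonneg: "L \<in> joining_lengths x y \<Longrightarrow> 0 \<le> L"
  unfolding joining_lengths_def using curve_length_nonneg by blast

lemma riem_dist_le: "L \<in> joining_lengths x y \<Longrightarrow> riem_dist M x y \<le> L"
  unfolding riem_dist_def joining_lengths_def[symmetric]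
  by (rule cInf_lower) (auto intro: bdd_belowI joining_lengths_nonneg)

text \<open>
  A curve and its reversal have the same length.
\<close>

lemma joining_lengths_sym: "joining_lengths x y \<subseteq> joining_lengths y x"
proof
  fix L assume "L \<in> joining_lengths x y"
  then obtain a b \<gamma> where \<gamma>: "piecewise_C1_curve M a b \<gamma>" "\<gamma> a = x" "\<gamma> b = y" and L: "L = curve_length M a b \<gamma>"
    unfolding joining_lengths_def by blast
  have "a < b" using \<gamma> by (simp add: piecewise_C1_curve_def)
  let ?\<gamma> = "\<lambda>s. \<gamma> (-1 * s + 0)"
  have "piecewise_C1_curve M (- b) (- a) ?\<gamma>"
    by (rule piecewise_C1_affine[OF \<gamma>(1)]) (use \<open>a < b\<close> in auto)
  from joining_lengthsI[OF this] have "curve_length M (- b) (- a) ?\<gamma> \<in> joining_lengths y x"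
    using \<gamma> by simp
  moreover have "curve_length M (- b) (- a) ?\<gamma> = L"
    using curve_length_affine[OF \<gamma>(1), of "-1" "-b" "-a" 0]
      Henstock_Kurzweil_Integration.integral_reflect_real[of b a "\<lambda>s. tnorm M (\<gamma> s) (velocity M \<gamma> s)"]
    by (auto simp: L curve_length_def)
  ultimately show "L \<in> joining_lengths y x" by simp
qed

lemma riem_dist_sym: "riem_dist M x y = riem_dist M y x"
proof -
  have "joining_lengths x y = joining_lengths y x" using joining_lengths_sym by blast
  then show ?thesis by (simp add: riem_dist_def joining_lengths_def[symmetric])
qed

lemma joining_lengths_trans:
  assumes "L \<in> joining_lengths x y" "L' \<in> joining_lengths y z"
  obtains L'' where "L'' \<in> joining_lengths x z" "L'' \<le> L + L'"
proof -
  obtain a b \<gamma> where \<gamma>: "piecewise_C1_curve M a b \<gamma>" "\<gamma> a = x" "\<gamma> b = y" and L: "L = curve_length M a b \<gamma>"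
    using assms unfolding joining_lengths_def by blast
  obtain c d \<delta>0 where \<delta>0: "piecewise_C1_curve M c d \<delta>0" "\<delta>0 c = y" "\<delta>0 d = z" and L': "L' = curve_length M c d \<delta>0"
    using assms unfolding joining_lengths_def by blast
  have lt: "a < b" "c < d" using \<gamma> \<delta>0 by (auto simp: piecewise_C1_curve_def)
  define k where "k = c - b"
  define \<delta> where "\<delta> = (\<lambda>s. \<delta>0 (1 * s + k))"
  have \<delta>: "piecewise_C1_curve M b (d - k) \<delta>" unfolding \<delta>_def
    by (rule piecewise_C1_affine[OF \<delta>0(1)]) (use lt in \<open>auto simp: k_def\<close>)
  have "curve_length M b (d - k) \<delta> = L'" unfolding \<delta>_def
    using curve_length_affine[OF \<delta>0(1), of 1 b "d - k" k]
      integral_shift_real_ivl[of c k d "\<lambda>s. tnorm M (\<delta>0 s) (velocity M \<delta>0 s)"]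
    by (auto simp: L' curve_length_def k_def)
  moreover have eq: "\<gamma> b = \<delta> b" "\<delta> (d - k) = z" using \<gamma> \<delta>0 by (auto simp: \<delta>_def k_def)
  ultimately show ?thesis
    using that joining_lengthsI[OF piecewise_C1_join[OF \<gamma>(1) \<delta> eq(1)]]
      curve_length_join_le[OF \<gamma>(1) \<delta>] lt \<gamma>(2) by (auto simp: L k_def)
qed

text \<open>
  The derivative of a coordinate segment is constant in its own chart, so in another chart it is the
  derivative of the transition map in one fixed direction, and this is continuous.
\<close>

lemma C1_curve_segment:
  assumes c: "c \<in> atlas M" and seg: "\<And>s. s \<in> {0..1} \<Longrightarrow> z + s *\<^sub>R v \<in> snd c ` fst c"
  shows "C1_curve_on M {0..1} (\<lambda>s. chart_inv c (z + s *\<^sub>R v))"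
proof -
  let ?I = "{0..1::real}" and ?\<gamma> = "\<lambda>s. chart_inv c (z + s *\<^sub>R v)"
  have "continuous_map (top_of_set ?I) (top_of_set (snd c ` fst c)) (\<lambda>s. z + s *\<^sub>R v)"
    using seg by (auto intro!: continuous_map_into_subtopology continuous_intros)
  from continuous_map_compose[OF this chart_inv_continuous[OF c]]
  have cont: "continuous_map (top_of_set ?I) (top_of M) ?\<gamma>" by (simp add: o_def)
  have in_c: "?\<gamma> s \<in> fst c" "snd c (?\<gamma> s) = z + s *\<^sub>R v" if "s \<in> ?I" for s
    using chart_inv_in[OF seg[OF that]] chart_chart_inv[OF seg[OF that]] .
  have "\<exists>D. continuous_on (?I \<inter> ?\<gamma> -` fst c') D \<and> (\<forall>s\<in>?I \<inter> ?\<gamma> -` fst c'.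
      ((snd c' \<circ> ?\<gamma>) has_vector_derivative D s) (at s within ?I))" if c': "c' \<in> atlas M" for c'
  proof (intro exI conjI ballI)
    let ?D = "\<lambda>z. frechet_derivative (snd c' \<circ> chart_inv c) (at z) v"
    have "continuous_on (snd c ` (fst c \<inter> fst c')) ?D" using transition_C1[OF c c'] by simp
    then show "continuous_on (?I \<inter> ?\<gamma> -` fst c') (\<lambda>s. ?D (z + s *\<^sub>R v))"
    proof (rule continuous_on_compose2)
      show "(\<lambda>s. z + s *\<^sub>R v) ` (?I \<inter> ?\<gamma> -` fst c') \<subseteq> snd c ` (fst c \<inter> fst c')"
      proof
        fix x assume "x \<in> (\<lambda>s. z + s *\<^sub>R v) ` (?I \<inter> ?\<gamma> -` fst c')"
        then obtain s where "s \<in> ?I" "?\<gamma> s \<in> fst c'" "x = z + s *\<^sub>R v" by blast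
        with in_c[of s] show "x \<in> snd c ` (fst c \<inter> fst c')"
          by (intro image_eqI[of _ _ "?\<gamma> s"]) auto
      qed
    qed (intro continuous_intros)
    fix s assume s: "s \<in> ?I \<inter> ?\<gamma> -` fst c'"
    have "((\<lambda>s. z + s *\<^sub>R v) has_vector_derivative v) (at s within ?I)"
      by (auto intro!: derivative_eq_intros)
    then have "((snd c \<circ> ?\<gamma>) has_vector_derivative v) (at s within ?I)"
      by (rule has_vector_derivative_transform[rotated 2]) (use s in_c in auto)
    then have "((snd c' \<circ> ?\<gamma>) has_vector_derivative transition_deriv c c' (?\<gamma> s) v) (at s within ?I)"
      by (rule chart_change_vector_derivative[rotated -1])
        (use c c' s in_c in \<open>auto simp: eventually_at_filter\<close>)
    then show "((snd c' \<circ> ?\<gamma>) has_vector_derivative ?D (z + s *\<^sub>R v)) (at s within ?I)"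
      using s in_c by (simp add: transition_deriv_def)
  qed
  with cont show ?thesis unfolding C1_curve_on_def by auto
qed

lemma C1_curve_imp_piecewise:
  assumes "C1_curve_on M {a..b} \<gamma>" "a < b"
  shows "piecewise_C1_curve M a b \<gamma>"
  using assms unfolding piecewise_C1_curve_def by (intro conjI exI[of _ "{a, b}"]) auto

lemma locally_joined:
  assumes "q \<in> points M"
  obtains N where "openin (top_of M) N" "q \<in> N" "\<And>y. y \<in> N \<Longrightarrow> joining_lengths q y \<noteq> {}"
proof -
  obtain c where c: "c \<in> atlas M" "q \<in> fst c" using chart_exists[OF assms] by blast
  obtain r where r: "r > 0" "ball (snd c q) r \<subseteq> snd c ` fst c"
    using chart_image_open[OF c(1)] c(2) unfolding open_contains_ball by blast
  let ?N = "{y \<in> fst c. snd c y \<in> ball (snd c q) r}"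
  have "openin (top_of M) ?N" by (rule chart_ball_openin[OF c(1)])
  moreover have "joining_lengths q y \<noteq> {}" if y: "y \<in> ?N" for y
  proof -
    let ?\<gamma> = "\<lambda>s. chart_inv c (snd c q + s *\<^sub>R (snd c y - snd c q))"
    have "snd c q + s *\<^sub>R (snd c y - snd c q) \<in> snd c ` fst c" if s: "s \<in> {0..1}" for s
    proof -
      have "norm (s *\<^sub>R (snd c y - snd c q)) \<le> norm (snd c y - snd c q)"
        using s by (simp add: mult_left_le_one_le)
      then have "snd c q + s *\<^sub>R (snd c y - snd c q) \<in> ball (snd c q) r"
        using y by (auto simp: dist_norm norm_minus_commute)
      then show ?thesis using r by blast
    qed
    then have "C1_curve_on M {0..1} ?\<gamma>" by (rule C1_curve_segment[OF c(1)])
    then have "piecewise_C1_curve M 0 1 ?\<gamma>" by (rule C1_curve_imp_piecewise) simp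
    from joining_lengthsI[OF this] show ?thesis using c y by auto
  qed
  ultimately show ?thesis using that[of ?N] c r by auto
qed

text \<open>
  The points that can be reached from \<open>x\<close> form an open and closed set, because every point is joined
  to all points of some neighbourhood by coordinate segments. Nonemptiness matters: the infimum of
  the empty set of reals is unspecified, so it is what makes the distance approximable by lengths.
\<close>

lemma joining_lengths_nonempty:
  assumes conn: "connected_space (top_of M)" and x: "x \<in> points M" and y: "y \<in> points M"
  shows "joining_lengths x y \<noteq> {}"
proof -
  let ?R = "{y \<in> points M. joining_lengths x y \<noteq> {}}"
  have trans: "joining_lengths u w \<noteq> {}" if "joining_lengths u v \<noteq> {}" "joining_lengths v w \<noteq> {}" for u v w
    using that joining_lengths_trans[of _ u v _ w] by blast
  have local: "\<exists>N. openin (top_of M) N \<and> q \<in> N \<and> (\<forall>y\<in>N. joining_lengths x q \<noteq> {} \<longleftrightarrow> joining_lengths x y \<noteq> {})"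
    if q: "q \<in> points M" for q
  proof -
    obtain N where N: "openin (top_of M) N" "q \<in> N" "\<And>y. y \<in> N \<Longrightarrow> joining_lengths q y \<noteq> {}"
      using locally_joined[OF q] by blast
    have "joining_lengths x q \<noteq> {} \<longleftrightarrow> joining_lengths x y \<noteq> {}" if "y \<in> N" for y
      using trans[of x q y] trans[of x y q] N(3)[OF that] joining_lengths_sym[of q y] by blast
    then show ?thesis using N(1,2) by (intro exI[of _ N] conjI ballI)
  qed
  have "openin (top_of M) ?R"
  proof (subst openin_subopen, intro ballI)
    fix q assume q: "q \<in> ?R"
    then have "q \<in> points M" by blast
    from local[OF this] obtain N where N: "openin (top_of M) N" "q \<in> N"
      "\<forall>y\<in>N. joining_lengths x q \<noteq> {} \<longleftrightarrow> joining_lengths x y \<noteq> {}" by (elim exE conjE)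
    have "N \<subseteq> ?R"
    proof
      fix y assume "y \<in> N"
      with bspec[OF N(3) this] q openin_subset[OF N(1)] show "y \<in> ?R" by auto
    qed
    with N(1,2) show "\<exists>T. openin (top_of M) T \<and> q \<in> T \<and> T \<subseteq> ?R" by blast
  qed
  moreover have "openin (top_of M) (points M - ?R)"
  proof (subst openin_subopen, intro ballI)
    fix q assume q: "q \<in> points M - ?R"
    then have "q \<in> points M" by blast
    from local[OF this] obtain N where N: "openin (top_of M) N" "q \<in> N"
      "\<forall>y\<in>N. joining_lengths x q \<noteq> {} \<longleftrightarrow> joining_lengths x y \<noteq> {}" by (elim exE conjE)
    have "N \<subseteq> points M - ?R"
    proof
      fix y assume "y \<in> N"
      with bspec[OF N(3) this] q openin_subset[OF N(1)] show "y \<in> points M - ?R" by auto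
    qed
    with N(1,2) show "\<exists>T. openin (top_of M) T \<and> q \<in> T \<and> T \<subseteq> points M - ?R" by blast
  qed
  ultimately have "openin (top_of M) ?R \<and> closedin (top_of M) ?R"
    by (simp add: closedin_def)
  moreover have "x \<in> ?R" using locally_joined[OF x] x by blast
  ultimately have "?R = points M" using conn unfolding connected_space_clopen_in by blast
  with y show ?thesis by blast
qed

lemma riem_dist_triangle:
  assumes conn: "connected_space (top_of M)" and "x \<in> points M" "y \<in> points M" "z \<in> points M"
  shows "riem_dist M x z \<le> riem_dist M x y + riem_dist M y z"
proof (rule field_le_epsilon)
  fix e :: real assume e: "e > 0"
  have near: "\<exists>L\<in>joining_lengths u v. L < riem_dist M u v + e / 2" if "u \<in> points M" "v \<in> points M" for u v
    unfolding riem_dist_def joining_lengths_def[symmetric]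
    by (rule cInf_lessD) (use e joining_lengths_nonempty[OF conn that] in auto)
  obtain L where L: "L \<in> joining_lengths x y" "L < riem_dist M x y + e / 2" using near assms by blast
  obtain L' where L': "L' \<in> joining_lengths y z" "L' < riem_dist M y z + e / 2" using near assms by blast
  obtain L'' where "L'' \<in> joining_lengths x z" "L'' \<le> L + L'"
    using joining_lengths_trans[OF L(1) L'(1)] by blast
  with riem_dist_le[of L'' x z] L L'
  show "riem_dist M x z \<le> riem_dist M x y + riem_dist M y z + e" by linarith
qed

end

section \<open>Orbits and singularities of the flow\<close>

locale closed_mfd_flow =
  fixes M :: "('a, 'e::euclidean_space) riem_mfd"
    and X :: "('a, 'e) vfield"
    and \<phi> :: "real \<Rightarrow> 'a \<Rightarrow> 'a"
  assumes closed_mfd: "closed_riem_manifold M"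
    and X_C1: "C1_vector_field M X"
    and flow: "flow_generated_by M X \<phi>"
begin

sublocale riemannian_mfd M
  using closed_mfd by unfold_locales (auto simp: closed_riem_manifold_def)

lemma connected: "connected_space (top_of M)" and compact: "compact_space (top_of M)"
  using closed_mfd by (auto simp: closed_riem_manifold_def)

lemma flow_0: "x \<in> points M \<Longrightarrow> \<phi> 0 x = x"
  and flow_add: "x \<in> points M \<Longrightarrow> \<phi> (s + t) x = \<phi> s (\<phi> t x)"
  and flow_has_vector_derivative: "\<And>c. x \<in> points M \<Longrightarrow> c \<in> atlas M \<Longrightarrow> \<phi> t x \<in> fst c \<Longrightarrow>
    ((\<lambda>s. snd c (\<phi> s x)) has_vector_derivative X (\<phi> t x) c) (at t)"
  using flow unfolding flow_generated_by_def by blast+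

lemma orbit_continuous:
  assumes "x \<in> points M" shows "continuous_map euclideanreal (top_of M) (\<lambda>t. \<phi> t x)"
proof -
  have "continuous_map euclideanreal (prod_topology euclideanreal (top_of M)) (\<lambda>t. (t, x))"
    using assms by (auto simp: continuous_map_pairwise o_def)
  moreover have "continuous_map (prod_topology euclideanreal (top_of M)) (top_of M) (\<lambda>(t, x). \<phi> t x)"
    using flow unfolding flow_generated_by_def by blast
  ultimately have "continuous_map euclideanreal (top_of M) ((\<lambda>(t, x). \<phi> t x) \<circ> (\<lambda>t. (t, x)))"
    by (rule continuous_map_compose)
  then show ?thesis by (simp add: o_def)
qed

lemma flow_points: "x \<in> points M \<Longrightarrow> \<phi> t x \<in> points M"
  using orbit_continuous unfolding continuous_map_def by auto

lemma X_tangent: "p \<in> points M \<Longrightarrow> X p \<in> tangent_space M p"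
  using X_C1 by (simp add: C1_vector_field_def)

lemma X_differentiable_in_chart:
  "c \<in> atlas M \<Longrightarrow> z \<in> snd c ` fst c \<Longrightarrow> (\<lambda>z. X (chart_inv c z) c) differentiable (at z)"
  using X_C1 by (auto simp: C1_vector_field_def)

text \<open>
  The velocity of an orbit is the vector field along it, and \<open>X\<close> is continuous in charts.
\<close>

lemma orbit_C1_curve:
  assumes "x \<in> points M" shows "C1_curve_on M I (\<lambda>s. \<phi> s x)"
proof -
  let ?\<gamma> = "\<lambda>s. \<phi> s x"
  have "continuous_map (top_of_set I) (top_of M) ?\<gamma>"
    using orbit_continuous[OF assms] by (rule continuous_map_from_subtopology)
  moreover have "\<exists>D. continuous_on (I \<inter> ?\<gamma> -` fst c) D \<and>
        (\<forall>s\<in>I \<inter> ?\<gamma> -` fst c. ((snd c \<circ> ?\<gamma>) has_vector_derivative D s) (at s within I))"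
    if c: "c \<in> atlas M" for c
  proof (intro exI conjI ballI)
    have D: "((snd c \<circ> ?\<gamma>) has_vector_derivative X (?\<gamma> s) c) (at s)" if "?\<gamma> s \<in> fst c" for s
      using flow_has_vector_derivative[OF assms c that] by (simp add: o_def)
    then show "((snd c \<circ> ?\<gamma>) has_vector_derivative X (?\<gamma> s) c) (at s within I)"
      if "s \<in> I \<inter> ?\<gamma> -` fst c" for s
      using that has_vector_derivative_at_within by blast
    have "continuous_on (I \<inter> ?\<gamma> -` fst c) (snd c \<circ> ?\<gamma>)"
      using D has_vector_derivative_continuous
      by (intro continuous_at_imp_continuous_on) blast
    moreover have "continuous_on (snd c ` fst c) (\<lambda>z. X (chart_inv c z) c)"
      using X_differentiable_in_chart[OF c]
      by (intro continuous_at_imp_continuous_on ballI differentiable_imp_continuous_within) 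
    moreover have "(snd c \<circ> ?\<gamma>) ` (I \<inter> ?\<gamma> -` fst c) \<subseteq> snd c ` fst c"
      unfolding image_comp[symmetric] by (intro image_mono) blast
    ultimately have "continuous_on (I \<inter> ?\<gamma> -` fst c) (\<lambda>s. X (chart_inv c ((snd c \<circ> ?\<gamma>) s)) c)"
      by (intro continuous_on_compose2[of "snd c ` fst c" "\<lambda>z. X (chart_inv c z) c" _ "snd c \<circ> ?\<gamma>"])
    moreover have "X (chart_inv c ((snd c \<circ> ?\<gamma>) s)) c = X (?\<gamma> s) c" if "s \<in> I \<inter> ?\<gamma> -` fst c" for s
      using that chart_inv_chart[OF c] by simp
    ultimately show "continuous_on (I \<inter> ?\<gamma> -` fst c) (\<lambda>s. X (?\<gamma> s) c)"
      by (rule continuous_on_eq)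
  qed
  ultimately show ?thesis unfolding C1_curve_on_def by auto
qed

lemma velocity_orbit:
  assumes "x \<in> points M" shows "velocity M (\<lambda>s. \<phi> s x) t = X (\<phi> t x)"
proof
  fix c
  show "velocity M (\<lambda>s. \<phi> s x) t c = X (\<phi> t x) c"
  proof (cases "c \<in> atlas M \<and> \<phi> t x \<in> fst c")
    case True
    then show ?thesis
      using flow_has_vector_derivative[OF assms, of c t]
      by (simp add: velocity_def o_def vector_derivative_at)
  next
    case False
    then have "X (\<phi> t x) c = 0"
      using X_tangent[OF flow_points[OF assms]] unfolding tangent_space_def by blast
    with False show ?thesis by (auto simp: velocity_def)
  qed
qed

lemma speed_bounded: obtains C where "C > 0" "\<And>p. p \<in> points M \<Longrightarrow> tnorm M p (X p) \<le> C"
proof -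
  have "compactin (top_of M) (points M)" using compact by (simp add: compact_space_def)
  then have "compact ((\<lambda>p. tnorm M p (X p)) ` points M)"
    using image_compactin[OF _ speed_continuous[OF X_C1]] by simp
  then obtain C where "C > 0" "\<forall>r\<in>(\<lambda>p. tnorm M p (X p)) ` points M. norm r \<le> C"
    using compact_imp_bounded bounded_pos by metis
  then show ?thesis using that[of C] by fastforce
qed

text \<open>
  On the compact complement of \<open>W\<close> the speed attains its infimum, at a nonsingular point.
\<close>

lemma speed_bounded_below:
  assumes W: "openin (top_of M) W" "Sing M X \<subseteq> W"
  obtains e where "e > 0" "\<And>p. p \<in> points M - W \<Longrightarrow> e \<le> tnorm M p (X p)"
proof (cases "points M - W = {}")
  case True
  then show ?thesis using that[of 1] by auto
next
  case False
  have "closedin (top_of M) (points M - W)" using W(1) by (simp add: closedin_def openin_subset double_diff)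
  then have "compactin (top_of M) (points M - W)" using compact closedin_compact_space by blast
  then have "compact ((\<lambda>p. tnorm M p (X p)) ` (points M - W))"
    using image_compactin[OF _ speed_continuous[OF X_C1]] by simp
  then obtain p where p: "p \<in> points M - W" "\<forall>q\<in>points M - W. tnorm M p (X p) \<le> tnorm M q (X q)"
    using compact_attains_inf[of "(\<lambda>p. tnorm M p (X p)) ` (points M - W)"] False by auto
  have "X p \<noteq> (\<lambda>c. 0)" using p(1) W(2) by (auto simp: Sing_def)
  then have "tnorm M p (X p) > 0" using p(1) X_tangent tnorm_pos by blast
  with p(2) show ?thesis using that by blast
qed

text \<open>
  The orbit segment is an admissible curve of length at most \<open>C \<bar>t\<bar>\<close> if \<open>t \<noteq> 0\<close>. Curves are defined on
  nondegenerate intervals, so for \<open>t = 0\<close> one goes back and forth along a segment of duration \<open>\<alpha> / 2\<close>.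
\<close>

lemma riem_dist_orbit_le:
  assumes C: "C > 0" "\<And>p. p \<in> points M \<Longrightarrow> tnorm M p (X p) \<le> C"
    and x: "x \<in> points M" and t: "0 < \<alpha>" "\<bar>t\<bar> \<le> \<alpha>"
  shows "riem_dist M x (\<phi> t x) \<le> C * \<alpha>"
proof -
  have pos: "riem_dist M x (\<phi> t x) \<le> C * t" if t: "t > 0" and x: "x \<in> points M" for t x
  proof -
    let ?\<gamma> = "\<lambda>s. \<phi> s x"
    have "piecewise_C1_curve M 0 t ?\<gamma>"
      using C1_curve_imp_piecewise orbit_C1_curve x t by blast
    from joining_lengthsI[OF this] have "riem_dist M x (\<phi> t x) \<le> curve_length M 0 t ?\<gamma>"
      using riem_dist_le flow_0[OF x] by simp
    also have "\<dots> = integral {0..t} (\<lambda>s. tnorm M (?\<gamma> s) (X (?\<gamma> s)))"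
      by (simp add: curve_length_def velocity_orbit[OF x])
    also have "\<dots> \<le> C * t"
    proof (cases "(\<lambda>s. tnorm M (?\<gamma> s) (X (?\<gamma> s))) integrable_on {0..t}")
      case True
      then have "integral {0..t} (\<lambda>s. tnorm M (?\<gamma> s) (X (?\<gamma> s))) \<le> integral {0..t} (\<lambda>s. C)"
        by (rule integral_le) (use C(2) flow_points[OF x] in auto)
      then show ?thesis using t by (simp add: mult.commute)
    qed (use C(1) t in \<open>simp add: not_integrable_integral\<close>)
    finally show ?thesis .
  qed
  have neg: "riem_dist M x (\<phi> (- t) x) \<le> C * t" if "t > 0" "x \<in> points M" for t x
  proof -
    have "\<phi> t (\<phi> (- t) x) = x" using flow_add[OF that(2), of t "- t"] flow_0[OF that(2)] by simp
    then show ?thesis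
      using pos[OF that(1) flow_points[OF that(2), of "- t"]] riem_dist_sym[of x] by simp
  qed
  consider "t > 0" | "t < 0" | "t = 0" by linarith
  then show ?thesis
  proof cases
    case 1
    then have "C * t \<le> C * \<alpha>" using C(1) t(2) by simp
    with pos[OF 1 x] show ?thesis by (rule order_trans)
  next
    case 2
    then have "C * (- t) \<le> C * \<alpha>" using C(1) t(2) by (intro mult_left_mono) auto
    moreover have "riem_dist M x (\<phi> t x) \<le> C * (- t)" using neg[of "- t" x] 2 x by simp
    ultimately show ?thesis by (rule order_trans[rotated])
  next
    case 3
    have "riem_dist M x x \<le> riem_dist M x (\<phi> (\<alpha> / 2) x) + riem_dist M (\<phi> (\<alpha> / 2) x) x"
      using riem_dist_triangle[OF connected] x flow_points by blast
    also have "\<dots> \<le> C * \<alpha>" using pos[of "\<alpha> / 2" x] x t(1) by (simp add: riem_dist_sym[of _ x])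
    finally show ?thesis using 3 x by (simp add: flow_0)
  qed
qed

text \<open>
  This is uniqueness of solutions at a zero of \<open>X\<close>. In a chart around \<open>q\<close>, differentiability at \<open>q\<close>
  gives \<open>norm (X z) \<le> B * norm (z - q)\<close> for \<open>z\<close> near \<open>q\<close>. If \<open>m\<close> is the largest distance from \<open>q\<close> in the chart that the
  orbit of \<open>q\<close> reaches for \<open>\<bar>s\<bar> \<le> \<eta>\<close>, the mean value inequality yields \<open>m \<le> \<eta> * B * m\<close>, so \<open>m = 0\<close> as soon
  as \<open>\<eta> * B < 1\<close>.
\<close>

lemma Sing_fixed_locally:
  assumes q: "q \<in> Sing M X"
  obtains \<eta> where "\<eta> > 0" "\<And>s. \<bar>s\<bar> \<le> \<eta> \<Longrightarrow> \<phi> s q = q"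
proof -
  have qM: "q \<in> points M" and Xq: "X q = (\<lambda>c. 0)" using q by (auto simp: Sing_def)
  obtain c where c: "c \<in> atlas M" "q \<in> fst c" using chart_exists[OF qM] by blast
  define z0 where "z0 = snd c q"
  let ?f = "\<lambda>z. X (chart_inv c z) c"
  have f0: "?f z0 = 0" using c Xq by (simp add: z0_def)
  obtain f' where f': "(?f has_derivative f') (at z0)"
    using X_differentiable_in_chart[OF c(1), of z0] c(2) unfolding z0_def differentiable_def by blast
  obtain K where K: "\<And>h. norm (f' h) \<le> norm h * K" "K > 0"
    using bounded_linear.pos_bounded[OF has_derivative_bounded_linear[OF f']] by blast
  define B where "B = K + 1"
  have B: "B > 0" using K by (simp add: B_def)
  obtain d where d: "d > 0" "\<And>z. norm (z - z0) < d \<Longrightarrow> norm (?f z - ?f z0 - f' (z - z0)) \<le> 1 * norm (z - z0)"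
    using f' unfolding has_derivative_at_alt by (metis zero_less_one)
  have f_le: "norm (?f z) \<le> B * norm (z - z0)" if "norm (z - z0) < d" for z
  proof -
    have "norm (?f z) \<le> norm (?f z - f' (z - z0)) + norm (f' (z - z0))"
      by (metis diff_add_cancel norm_triangle_ineq)
    then show ?thesis using d(2)[OF that] K(1)[of "z - z0"] f0 by (simp add: B_def algebra_simps)
  qed
  let ?N = "{p \<in> fst c. snd c p \<in> ball z0 d}"
  have N: "openin (top_of M) ?N" by (rule chart_ball_openin[OF c(1)])
  have "eventually (\<lambda>s. \<phi> s q \<in> ?N) (at 0 within UNIV)"
    by (rule eventually_in_open[OF _ N])
      (use orbit_continuous[OF qM] c d flow_0[OF qM] in \<open>auto simp: z0_def\<close>)
  then obtain r where r: "r > 0" "\<And>s. s \<noteq> 0 \<Longrightarrow> \<bar>s\<bar> < r \<Longrightarrow> \<phi> s q \<in> ?N"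
    unfolding eventually_at by (auto simp: dist_real_def)
  \<comment> \<open>\<open>r / 2\<close> keeps the orbit in the chart ball, \<open>1 / (2 * B)\<close> makes \<open>\<eta> * B\<close> less than \<open>1\<close>.\<close>
  define \<eta> where "\<eta> = min (r / 2) (1 / (2 * B))"
  have \<eta>: "\<eta> > 0" "\<eta> < r" "\<eta> * B \<le> 1 / 2"
    using r(1) B by (auto simp: \<eta>_def min_def field_simps)
  define u where "u s = snd c (\<phi> s q)" for s
  have in_N: "\<phi> s q \<in> ?N" if "s \<in> {-\<eta>..\<eta>}" for s
    using r(2)[of s] that \<eta> c d flow_0[OF qM] by (cases "s = 0") (auto simp: z0_def)
  have du: "(u has_vector_derivative X (\<phi> s q) c) (at s within {-\<eta>..\<eta>})" if "s \<in> {-\<eta>..\<eta>}" for s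
    using flow_has_vector_derivative[OF qM c(1)] in_N[OF that] has_vector_derivative_at_within
    unfolding u_def by blast
  then have "continuous_on {-\<eta>..\<eta>} u" by (rule continuous_on_vector_derivative)
  then have "continuous_on {-\<eta>..\<eta>} (\<lambda>s. norm (u s - z0))" by (intro continuous_intros)
  then have "\<exists>s0\<in>{-\<eta>..\<eta>}. \<forall>s\<in>{-\<eta>..\<eta>}. norm (u s - z0) \<le> norm (u s0 - z0)"
    using \<eta>(1) by (intro continuous_attains_sup) auto
  then obtain s0 where s0: "s0 \<in> {-\<eta>..\<eta>}" "\<And>s. s \<in> {-\<eta>..\<eta>} \<Longrightarrow> norm (u s - z0) \<le> norm (u s0 - z0)"
    by blast
  define m where "m = norm (u s0 - z0)"
  have u0: "u 0 = z0" "X (\<phi> 0 q) c = 0" using flow_0[OF qM] Xq by (auto simp: u_def z0_def)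
  have "norm (X (\<phi> s q) c) \<le> B * m" if "s \<in> {-\<eta>..\<eta>}" for s
  proof -
    have "norm (u s - z0) < d" using in_N[OF that] by (auto simp: u_def dist_norm norm_minus_commute)
    then have "norm (?f (u s)) \<le> B * norm (u s - z0)" by (rule f_le)
    also have "\<dots> \<le> B * m" using s0(2)[OF that] B by (simp add: m_def)
    finally show ?thesis using in_N[OF that] c by (simp add: u_def)
  qed
  then have "norm (u s0 - u 0 - (s0 - 0) *\<^sub>R X (\<phi> 0 q) c) \<le> norm (s0 - 0) * (B * m)"
    using \<eta>(1) s0(1) u0
    by (intro vector_differentiable_bound_linearization[where S = "{-\<eta>..\<eta>}"] du)
      (auto simp: closed_segment_eq_real_ivl)
  then have "m \<le> \<bar>s0\<bar> * (B * m)" using u0 by (simp add: m_def)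
  also have "\<dots> \<le> \<eta> * (B * m)"
    using s0(1) B by (intro mult_right_mono) (auto simp: m_def)
  also have "\<dots> \<le> 1 / 2 * m"
    using mult_right_mono[OF \<eta>(3), of m] by (simp add: m_def mult.assoc)
  finally have "m \<le> 0" by simp
  have "\<phi> s q = q" if "\<bar>s\<bar> \<le> \<eta>" for s
  proof -
    have s: "s \<in> {-\<eta>..\<eta>}" using that by auto
    then have "u s = z0" using s0(2)[OF s] \<open>m \<le> 0\<close> by (simp add: m_def)
    then show ?thesis using in_N[OF s] c chart_inv_chart[OF c(1)] unfolding u_def z0_def
      by (metis (no_types, lifting) mem_Collect_eq)
  qed
  with \<eta>(1) show ?thesis using that by blast
qed

text \<open>
  Every time is a multiple of an arbitrarily short one.
\<close>

lemma Sing_fixed: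
  assumes q: "q \<in> Sing M X" shows "\<phi> t q = q"
proof -
  have qM: "q \<in> points M" using q by (auto simp: Sing_def)
  obtain \<eta> where \<eta>: "\<eta> > 0" "\<And>s. \<bar>s\<bar> \<le> \<eta> \<Longrightarrow> \<phi> s q = q" using Sing_fixed_locally[OF q] by blast
  obtain n where n: "\<bar>t\<bar> / \<eta> < real n" using reals_Archimedean2 by blast
  then have "n > 0" using \<eta>(1) by (cases n) (auto simp: divide_less_0_iff)
  with n \<eta>(1) have "\<bar>t / real n\<bar> \<le> \<eta>" by (simp add: field_simps)
  from \<eta>(2)[OF this] have step: "\<phi> (t / real n) q = q" .
  have "\<phi> (real k * (t / real n)) q = q" for k
  proof (induction k)
    case (Suc k)
    have "real (Suc k) * (t / real n) = real k * (t / real n) + t / real n"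
      by (simp add: algebra_simps add_divide_distrib)
    then show ?case using Suc step by (simp only: flow_add[OF qM])
  qed (simp add: flow_0[OF qM])
  from this[of n] show ?thesis using \<open>n > 0\<close> by simp
qed

lemma nonsing_flow:
  assumes "x \<in> nonsing M X" shows "\<phi> t x \<in> nonsing M X"
proof -
  have x: "x \<in> points M" "x \<notin> Sing M X" using assms by (auto simp: nonsing_def)
  have "\<phi> t x \<notin> Sing M X"
  proof
    assume *: "\<phi> t x \<in> Sing M X"
    have "x = \<phi> (- t) (\<phi> t x)" using flow_add[OF x(1), of "-t" t] flow_0[OF x(1)] by simp
    also have "\<dots> = \<phi> t x" by (rule Sing_fixed[OF *])
    finally show False using * x(2) by simp
  qed
  then show ?thesis using flow_points[OF x(1)] by (simp add: nonsing_def)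
qed

text \<open>
  An orbit contained in \<open>U\<close> lies in the maximal invariant subset of \<open>U\<close>, so it consists of fixed points;
  but a fixed point has no least positive period.
\<close>

lemma periodic_orbit_escapes:
  assumes U: "(\<Inter>t. \<phi> t ` U) = Sing M X" and x: "x \<in> points M" and p: "is_period \<phi> x p"
  obtains s where "\<phi> s x \<notin> U"
proof -
  have "\<exists>s. \<phi> s x \<notin> U"
  proof (rule ccontr)
    assume "\<nexists>s. \<phi> s x \<notin> U"
    then have "x \<in> \<phi> t ` U" for t
      using flow_add[OF x, of t "-t"] flow_0[OF x] by (intro image_eqI[of _ _ "\<phi> (- t) x"]) auto
    then have "x \<in> Sing M X" using U by blast
    then have "\<phi> (p / 2) x = x" by (rule Sing_fixed)
    then show False using p unfolding is_period_def by auto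
  qed
  then show ?thesis using that by blast
qed


section \<open>Counting periodic orbits\<close>

lemma flow_mult_period:
  assumes x: "x \<in> points M" and p: "\<phi> p x = x"
  shows "\<phi> (of_int k * p) x = x"
proof -
  have nat: "\<phi> (real n * p) x = x" for n
  proof (induction n)
    case (Suc n)
    have "real (Suc n) * p = real n * p + p" by (simp add: algebra_simps)
    then show ?case using Suc p by (simp only: flow_add[OF x])
  qed (simp add: flow_0[OF x])
  show ?thesis
  proof (cases "k \<ge> 0")
    case True
    then show ?thesis using nat[of "nat k"] by simp
  next
    case False
    then have "x = \<phi> (of_int k * p) (\<phi> (real (nat (- k)) * p) x)"
      by (simp add: flow_0[OF x] flip: flow_add[OF x])
    then show ?thesis using nat by simp
  qed
qed

lemma flow_mod_period:
  assumes x: "x \<in> points M" and p: "\<phi> p x = x"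
  shows "\<phi> (s - of_int k * p) x = \<phi> s x"
proof -
  have "\<phi> s x = \<phi> ((s - of_int k * p) + of_int k * p) x" by simp
  also have "\<dots> = \<phi> (s - of_int k * p) x"
    by (simp only: flow_add[OF x] flow_mult_period[OF x p])
  finally show ?thesis by simp
qed

lemma orbit_eqI:
  assumes x: "x \<in> points M" and x': "x' \<in> points M" and "\<phi> a x' = \<phi> b x"
  shows "range (\<lambda>s. \<phi> s x) = range (\<lambda>s. \<phi> s x')"
proof -
  have sub: "range (\<lambda>s. \<phi> s u) \<subseteq> range (\<lambda>s. \<phi> s v)"
    if "u \<in> points M" "v \<in> points M" "\<phi> c v = \<phi> d u" for u v c d
  proof safe
    fix s
    have "\<phi> s u = \<phi> ((s - d) + d) u" by simp
    also have "\<dots> = \<phi> (s - d) (\<phi> c v)" by (simp only: flow_add[OF that(1)] that(3))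
    also have "\<dots> = \<phi> (s - d + c) v" by (simp only: flow_add[OF that(2)])
    finally show "\<phi> s u \<in> range (\<lambda>s. \<phi> s v)" by simp
  qed
  show ?thesis using sub[OF x x' assms(3)] sub[OF x' x assms(3)[symmetric]] by blast
qed

text \<open>
  The form in which expansivity is used: orbits that are \<open>\<delta>\<close>-close up to a time change coincide.
\<close>

definition separating :: "real \<Rightarrow> bool" where
  "separating \<delta> \<longleftrightarrow> (\<forall>x\<in>points M. \<forall>y\<in>points M. \<forall>h h'.
     homeomorphism (UNIV :: real set) (UNIV :: real set) h h' \<and> strict_mono h \<and> h 0 = 0 \<and>
     (\<forall>s. riem_dist M (\<phi> s x) (\<phi> (h s) y) \<le> \<delta>) \<longrightarrow>
     range (\<lambda>s. \<phi> s x) = range (\<lambda>s. \<phi> s y))"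

text \<open>
  Expansivity is applied with \<open>\<epsilon> = 1\<close>: whatever the time lag, it yields a common point of the two
  orbits, and then they are equal.
\<close>

lemma kstar_expansive_imp_separating:
  assumes "kstar_expansive M \<phi>"
  obtains \<delta> where "\<delta> > 0" "separating \<delta>"
proof -
  have "\<exists>\<delta>>0. \<forall>x\<in>points M. \<forall>y\<in>points M. \<forall>h h'.
        homeomorphism (UNIV :: real set) (UNIV :: real set) h h' \<and> strict_mono h \<and> h 0 = 0 \<and>
        (\<forall>s. riem_dist M (\<phi> s x) (\<phi> (h s) y) \<le> \<delta>) \<longrightarrow>
        (\<exists>s0. \<phi> (h s0) y \<in> (\<lambda>s. \<phi> s x) ` {s0 - 1..s0 + 1})"
    using assms unfolding kstar_expansive_def by (elim allE[of _ 1]) simp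
  then obtain \<delta> where \<delta>: "\<delta> > 0" and exp: "\<forall>x\<in>points M. \<forall>y\<in>points M. \<forall>h h'.
        homeomorphism (UNIV :: real set) (UNIV :: real set) h h' \<and> strict_mono h \<and> h 0 = 0 \<and>
        (\<forall>s. riem_dist M (\<phi> s x) (\<phi> (h s) y) \<le> \<delta>) \<longrightarrow>
        (\<exists>s0. \<phi> (h s0) y \<in> (\<lambda>s. \<phi> s x) ` {s0 - 1..s0 + 1})"
    by (elim exE conjE)
  have "separating \<delta>" unfolding separating_def
  proof (intro ballI allI impI)
    fix x y h h' assume x: "x \<in> points M" and y: "y \<in> points M"
      and h: "homeomorphism (UNIV :: real set) (UNIV :: real set) h h' \<and> strict_mono h \<and> h 0 = 0 \<and>
        (\<forall>s. riem_dist M (\<phi> s x) (\<phi> (h s) y) \<le> \<delta>)"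
    from exp[rule_format, OF x y, of h h'] h
    obtain s0 s where "\<phi> (h s0) y = \<phi> s x" by auto
    then show "range (\<lambda>s. \<phi> s x) = range (\<lambda>s. \<phi> s y)" by (rule orbit_eqI[OF x y])
  qed
  with \<delta> show ?thesis by (rule that)
qed

text \<open>
  Closeness during one period of \<open>x\<close> propagates to all times: the time change \<open>s \<mapsto> (p' / p) s\<close> carries
  periods of \<open>x\<close> to periods of \<open>x'\<close>, so both points can be followed modulo their periods.
\<close>

lemma shadowing_periodic_orbits_eq:
  assumes sep: "separating \<delta>"
    and C: "C > 0" "\<And>p. p \<in> points M \<Longrightarrow> tnorm M p (X p) \<le> C"
    and x: "x \<in> points M" "p > 0" "\<phi> p x = x" and x': "x' \<in> points M" "p' > 0" "\<phi> p' x' = x'"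
    and \<alpha>: "\<alpha> > 0" "\<bar>p - p'\<bar> \<le> \<alpha>"
    and near: "\<And>r. 0 \<le> r \<Longrightarrow> r \<le> p \<Longrightarrow> riem_dist M (\<phi> r x) (\<phi> r x') \<le> \<beta>"
    and \<delta>: "\<beta> + C * \<alpha> \<le> \<delta>"
  shows "range (\<lambda>s. \<phi> s x) = range (\<lambda>s. \<phi> s x')"
proof -
  define h where "h = (\<lambda>s. s * (p' / p))"
  have hom: "homeomorphism UNIV UNIV h (\<lambda>s. s * (p / p'))"
    unfolding h_def using x(2) x'(2) by (intro homeomorphismI continuous_intros) auto
  have mono: "strict_mono h" unfolding h_def strict_mono_def using x(2) x'(2)
    by (simp add: divide_strict_right_mono)
  have "riem_dist M (\<phi> s x) (\<phi> (h s) x') \<le> \<delta>" for s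
  proof -
    \<comment> \<open>Reduce \<open>s\<close> modulo the period of \<open>x\<close>; then \<open>h s\<close> is reduced modulo that of \<open>x'\<close>.\<close>
    define k where "k = \<lfloor>s / p\<rfloor>"
    define r where "r = s - of_int k * p"
    have r: "0 \<le> r" "r \<le> p"
      using floor_divide_lower[OF x(2), of s] floor_divide_upper[OF x(2), of s]
      by (auto simp: r_def k_def algebra_simps)
    have "h s - of_int k * p' = h r" using x(2) by (simp add: h_def r_def field_simps)
    then have hs: "\<phi> (h s) x' = \<phi> (h r) x'" using flow_mod_period[OF x'(1,3), of "h s" k] by simp
    have "h r - r = r / p * (p' - p)" using x(2) by (simp add: h_def field_simps)
    then have "\<bar>h r - r\<bar> \<le> 1 * \<bar>p' - p\<bar>"
      unfolding abs_mult using r x(2) by (simp only: abs_mult) (intro mult_right_mono; simp)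
    then have hr: "\<bar>h r - r\<bar> \<le> \<alpha>" using \<alpha>(2) by simp
    have "\<phi> (h r) x' = \<phi> ((h r - r) + r) x'" by simp
    also have "\<dots> = \<phi> (h r - r) (\<phi> r x')" by (rule flow_add[OF x'(1)])
    finally have "riem_dist M (\<phi> r x') (\<phi> (h r) x') \<le> C * \<alpha>"
      using riem_dist_orbit_le[OF C flow_points[OF x'(1)] \<alpha>(1) hr] by simp
    moreover have "riem_dist M (\<phi> r x) (\<phi> (h r) x')
        \<le> riem_dist M (\<phi> r x) (\<phi> r x') + riem_dist M (\<phi> r x') (\<phi> (h r) x')"
      by (rule riem_dist_triangle[OF connected]) (use flow_points x(1) x'(1) in auto)
    ultimately have "riem_dist M (\<phi> r x) (\<phi> (h r) x') \<le> \<delta>" using near[OF r] \<delta> by linarith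
    then show ?thesis using hs flow_mod_period[OF x(1,3), of s k] by (simp add: r_def)
  qed
  moreover have "h 0 = 0" by (simp add: h_def)
  ultimately show ?thesis
    using sep[unfolded separating_def, rule_format, OF x(1) x'(1)] hom mono by blast
qed

text \<open>
  The orbit of \<open>z\<close> stays nonsingular, so its speed, by which the rescaled distance divides, is positive.
\<close>

lemma rescaled_ball_dist_le:
  assumes C: "\<And>p. p \<in> points M \<Longrightarrow> tnorm M p (X p) \<le> C"
    and z: "z \<in> nonsing M X" and y: "y \<in> rescaled_ball M X \<phi> z t \<epsilon>" and "\<epsilon> > 0" and r: "0 \<le> r" "r \<le> t"
  shows "riem_dist M (\<phi> r z) (\<phi> r y) \<le> \<epsilon> * C"
proof -
  let ?n = "tnorm M (\<phi> r z) (X (\<phi> r z))"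
  have "\<phi> r z \<in> nonsing M X" using z by (rule nonsing_flow)
  then have "\<phi> r z \<in> points M" "X (\<phi> r z) \<noteq> (\<lambda>c. 0)" by (auto simp: nonsing_def Sing_def)
  then have n: "0 < ?n" "?n \<le> C" using tnorm_pos X_tangent C by blast+
  have "ereal (riem_dist M (\<phi> r z) (\<phi> r y) / ?n) \<le> rescaled_dist M X \<phi> t z y"
    unfolding rescaled_dist_def by (rule SUP_upper) (use r in auto)
  also have "\<dots> < ereal \<epsilon>" using y by (simp add: rescaled_ball_def)
  finally have "riem_dist M (\<phi> r z) (\<phi> r y) < \<epsilon> * ?n" using n by (simp add: pos_divide_less_eq)
  also have "\<dots> \<le> \<epsilon> * C" using n \<open>\<epsilon> > 0\<close> by simp
  finally show ?thesis by simp
qed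

text \<open>
  The pairs \<open>(k, z)\<close>, where \<open>k\<close> is the integer part of \<open>p / \<alpha>\<close> and \<open>z \<in> F\<close> is the centre of a ball that
  contains a fast point of the orbit, encode the periodic orbits injectively.
\<close>

lemma num_periodic_orbits_le:
  assumes sep: "separating \<delta>"
    and C: "C > 0" "\<And>p. p \<in> points M \<Longrightarrow> tnorm M p (X p) \<le> C"
    and esc: "\<And>x p. x \<in> points M \<Longrightarrow> is_period \<phi> x p \<Longrightarrow> \<exists>s. \<phi> s x \<in> speed_ge M X \<epsilon>"
    and \<alpha>: "\<alpha> > 0" and \<epsilon>: "\<epsilon> > 0" "2 * (\<epsilon> * C) + C * \<alpha> \<le> \<delta>"
    and F: "rescaled_spanning M X \<phi> t \<epsilon> F" "finite F" and t: "t \<ge> 0"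
  shows "num_periodic_orbits M \<phi> t \<le> enat ((nat \<lfloor>t / \<alpha>\<rfloor> + 1) * card F)"
proof -
  let ?orb = "\<lambda>x. range (\<lambda>s. \<phi> s x)"
  let ?P = "{?orb x | x. x \<in> points M \<and> (\<exists>p. is_period \<phi> x p \<and> p \<le> t)}"
  \<comment> \<open>A triple consists of a fast point of the orbit, its period and the centre of a covering ball.\<close>
  let ?good = "\<lambda>Q (x, p, z). Q = ?orb x \<and> x \<in> points M \<and> 0 < p \<and> p \<le> t \<and> \<phi> p x = x \<and>
      z \<in> F \<and> x \<in> rescaled_ball M X \<phi> z t \<epsilon>"
  have "\<exists>w. ?good Q w" if Q: "Q \<in> ?P" for Q
  proof -
    obtain y p where y: "Q = ?orb y" "y \<in> points M" "is_period \<phi> y p" "p \<le> t" using Q by blast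
    obtain s where s: "\<phi> s y \<in> speed_ge M X \<epsilon>" using esc[OF y(2,3)] by blast
    then obtain z where z: "z \<in> F" "\<phi> s y \<in> rescaled_ball M X \<phi> z t \<epsilon>"
      using F(1) unfolding rescaled_spanning_def by blast
    have pts: "\<phi> s y \<in> points M" by (rule flow_points[OF y(2)])
    have "\<phi> p (\<phi> s y) = \<phi> s (\<phi> p y)" by (simp add: add.commute flip: flow_add[OF y(2)])
    then have "\<phi> p (\<phi> s y) = \<phi> s y" using y(3) by (simp add: is_period_def)
    moreover have "?orb (\<phi> s y) = ?orb y"
      by (rule orbit_eqI[OF pts y(2), of s 0]) (simp add: flow_0[OF pts])
    ultimately have "?good Q (\<phi> s y, p, z)"
      using y z pts by (simp add: is_period_def)
    then show ?thesis by blast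
  qed
  then have "\<forall>Q\<in>?P. \<exists>w. ?good Q w" by blast
  from bchoice[OF this] obtain w where w: "\<forall>Q\<in>?P. ?good Q (w Q)" by (rule exE)
  let ?code = "\<lambda>Q. (nat \<lfloor>fst (snd (w Q)) / \<alpha>\<rfloor>, snd (snd (w Q)))"
  have good: "Q = ?orb (fst (w Q))" "fst (w Q) \<in> points M" "0 < fst (snd (w Q))" "fst (snd (w Q)) \<le> t"
    "\<phi> (fst (snd (w Q))) (fst (w Q)) = fst (w Q)" "snd (snd (w Q)) \<in> F"
    "fst (w Q) \<in> rescaled_ball M X \<phi> (snd (snd (w Q))) t \<epsilon>" if "Q \<in> ?P" for Q
    using bspec[OF w that] by (auto simp: case_prod_beta)
  have inj: "inj_on ?code ?P"
  proof (rule inj_onI)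
    fix Q Q' assume Q: "Q \<in> ?P" and Q': "Q' \<in> ?P" and code: "?code Q = ?code Q'"
    obtain x p z where wQ: "w Q = (x, p, z)" by (cases "w Q") auto
    obtain x' p' z' where wQ': "w Q' = (x', p', z')" by (cases "w Q'") auto
    note g = good[OF Q, unfolded wQ fst_conv snd_conv]
    note g' = good[OF Q', unfolded wQ' fst_conv snd_conv]
    have "z' = z" using code wQ wQ' by simp
    have "nat \<lfloor>p / \<alpha>\<rfloor> = nat \<lfloor>p' / \<alpha>\<rfloor>" using code wQ wQ' by simp
    moreover have "0 \<le> p / \<alpha>" "0 \<le> p' / \<alpha>" using g(3) g'(3) \<alpha> by simp_all
    ultimately have "\<lfloor>p / \<alpha>\<rfloor> = \<lfloor>p' / \<alpha>\<rfloor>" by (simp add: eq_nat_nat_iff)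
    then have "\<bar>p / \<alpha> - p' / \<alpha>\<bar> \<le> 1"
      using floor_correct[of "p / \<alpha>"] floor_correct[of "p' / \<alpha>"] by linarith
    then have "\<bar>p - p'\<bar> / \<alpha> \<le> 1" using \<alpha> by (simp flip: diff_divide_distrib)
    then have close: "\<bar>p - p'\<bar> \<le> \<alpha>" using \<alpha> by simp
    have z: "z \<in> nonsing M X" using F(1) g(6) unfolding rescaled_spanning_def by blast
    have near: "riem_dist M (\<phi> r x) (\<phi> r x') \<le> 2 * (\<epsilon> * C)" if r: "0 \<le> r" "r \<le> p" for r
    proof -
      have "r \<le> t" using r g(4) by simp
      have "riem_dist M (\<phi> r z) (\<phi> r x) \<le> \<epsilon> * C"
        by (rule rescaled_ball_dist_le[OF C(2) z g(7) \<epsilon>(1) r(1) \<open>r \<le> t\<close>])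
      moreover have "riem_dist M (\<phi> r z) (\<phi> r x') \<le> \<epsilon> * C"
        by (rule rescaled_ball_dist_le[OF C(2) z g'(7)[unfolded \<open>z' = z\<close>] \<epsilon>(1) r(1) \<open>r \<le> t\<close>])
      moreover have "riem_dist M (\<phi> r x) (\<phi> r x')
          \<le> riem_dist M (\<phi> r x) (\<phi> r z) + riem_dist M (\<phi> r z) (\<phi> r x')"
        by (rule riem_dist_triangle[OF connected]) (use z g(2) g'(2) flow_points in \<open>auto simp: nonsing_def\<close>)
      ultimately show ?thesis using riem_dist_sym[of "\<phi> r x" "\<phi> r z"] by linarith
    qed
    have "?orb x = ?orb x'"
      by (rule shadowing_periodic_orbits_eq[OF sep C(1) _ g(2,3,5) g'(2,3,5) \<alpha> close _ \<epsilon>(2)])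
        (simp_all add: C(2) near)
    then show "Q = Q'" using g(1) g'(1) by simp
  qed
  have sub: "?code ` ?P \<subseteq> {..nat \<lfloor>t / \<alpha>\<rfloor>} \<times> F"
  proof
    fix v assume "v \<in> ?code ` ?P"
    then obtain Q where Q: "Q \<in> ?P" "v = ?code Q" by blast
    have "fst (snd (w Q)) / \<alpha> \<le> t / \<alpha>" using good(4)[OF Q(1)] \<alpha> by (simp add: divide_right_mono)
    then have "nat \<lfloor>fst (snd (w Q)) / \<alpha>\<rfloor> \<le> nat \<lfloor>t / \<alpha>\<rfloor>" by (intro nat_mono floor_mono)
    then show "v \<in> {..nat \<lfloor>t / \<alpha>\<rfloor>} \<times> F" using good(6)[OF Q(1)] Q(2) by simp
  qed
  have fin: "finite ({..nat \<lfloor>t / \<alpha>\<rfloor>} \<times> F)" using F(2) by simp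
  have "finite ?P" using inj sub fin by (rule inj_on_finite)
  moreover have "card ?P \<le> card ({..nat \<lfloor>t / \<alpha>\<rfloor>} \<times> F)" using inj sub fin by (rule card_inj_on_le)
  ultimately show ?thesis
    by (simp add: num_periodic_orbits_def ecard_def card_cartesian_product)
qed

end

section \<open>Exponential growth rates\<close>

lemma log_enat_mono: "m \<le> n \<Longrightarrow> log_enat m \<le> log_enat n"
  by (cases m; cases n) (auto simp: log_enat_def)

text \<open>
  A smaller \<open>\<epsilon>\<close> leaves more points to be covered by smaller balls.
\<close>

lemma min_spanning_antimono:
  assumes "\<epsilon>' \<le> \<epsilon>"
  shows "min_spanning M X \<phi> t \<epsilon> \<le> min_spanning M X \<phi> t \<epsilon>'"
  unfolding min_spanning_def
proof (rule INF_superset_mono)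
  show "{F. rescaled_spanning M X \<phi> t \<epsilon>' F} \<subseteq> {F. rescaled_spanning M X \<phi> t \<epsilon> F}"
  proof safe
    fix F assume F: "rescaled_spanning M X \<phi> t \<epsilon>' F"
    have "speed_ge M X \<epsilon> \<subseteq> speed_ge M X \<epsilon>'" using assms by (auto simp: speed_ge_def)
    moreover have "rescaled_ball M X \<phi> x t \<epsilon>' \<subseteq> rescaled_ball M X \<phi> x t \<epsilon>" for x
      using assms by (auto simp: rescaled_ball_def intro: less_le_trans)
    ultimately show "rescaled_spanning M X \<phi> t \<epsilon> F" using F unfolding rescaled_spanning_def by blast
  qed
qed auto

lemma min_spanning_attained:
  assumes "min_spanning M X \<phi> t \<epsilon> = enat n"
  obtains F where "rescaled_spanning M X \<phi> t \<epsilon> F" "finite F" "card F \<le> n"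
proof -
  have "min_spanning M X \<phi> t \<epsilon> < enat (Suc n)" using assms by simp
  then obtain F where F: "rescaled_spanning M X \<phi> t \<epsilon> F" "ecard F < enat (Suc n)"
    unfolding min_spanning_def INF_less_iff by blast
  then show ?thesis using that[of F] by (auto simp: ecard_def split: if_splits)
qed

lemma Lim_at_right_0_antimono:
  fixes G :: "real \<Rightarrow> ereal"
  assumes anti: "\<And>a b. 0 < a \<Longrightarrow> a \<le> b \<Longrightarrow> G b \<le> G a"
  shows "Lim (at_right 0) G = (SUP \<epsilon>\<in>{0<..}. G \<epsilon>)"
proof (rule tendsto_Lim)
  show "(G \<longlongrightarrow> (SUP \<epsilon>\<in>{0<..}. G \<epsilon>)) (at_right 0)"
  proof (rule order_tendstoI)
    fix a assume "a < (SUP \<epsilon>\<in>{0<..}. G \<epsilon>)"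
    then obtain e where e: "e > 0" "a < G e" unfolding less_SUP_iff by auto
    then have "eventually (\<lambda>\<epsilon>. \<epsilon> \<in> {0<..<e}) (at_right 0)" by (intro eventually_at_right_real)
    then show "eventually (\<lambda>\<epsilon>. a < G \<epsilon>) (at_right 0)"
      by eventually_elim (use e anti in \<open>force intro: less_le_trans\<close>)
  next
    fix a assume a: "(SUP \<epsilon>\<in>{0<..}. G \<epsilon>) < a"
    have "eventually (\<lambda>\<epsilon>::real. \<epsilon> \<in> {0<..<1}) (at_right 0)" by (intro eventually_at_right_real) simp
    then show "eventually (\<lambda>\<epsilon>. G \<epsilon> < a) (at_right 0)"
    proof eventually_elim
      case (elim \<epsilon>)
      then have "G \<epsilon> \<le> (SUP \<epsilon>\<in>{0<..}. G \<epsilon>)" by (intro SUP_upper) auto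
      with a show ?case by (rule le_less_trans[rotated])
    qed
  qed
qed simp

text \<open>
  By monotonicity in \<open>\<epsilon>\<close>, the limit that defines the entropy exists and is a supremum.
\<close>

lemma rescaled_entropy_ge:
  assumes "\<epsilon> > 0"
  shows "Limsup at_top (\<lambda>t::real. ereal (1 / t) * log_enat (min_spanning M X \<phi> t \<epsilon>))
    \<le> rescaled_entropy M X \<phi>"
proof -
  let ?G = "\<lambda>\<epsilon>::real. Limsup at_top (\<lambda>t::real. ereal (1 / t) * log_enat (min_spanning M X \<phi> t \<epsilon>))"
  have anti: "?G b \<le> ?G a" if "a \<le> b" for a b
  proof (rule Limsup_mono)
    show "eventually (\<lambda>t::real. ereal (1 / t) * log_enat (min_spanning M X \<phi> t b)
        \<le> ereal (1 / t) * log_enat (min_spanning M X \<phi> t a)) at_top"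
      using eventually_gt_at_top[of 0]
      by eventually_elim (intro ereal_mult_left_mono log_enat_mono min_spanning_antimono that; simp)
  qed
  have "rescaled_entropy M X \<phi> = (SUP \<epsilon>\<in>{0<..}. ?G \<epsilon>)"
    unfolding rescaled_entropy_def by (rule Lim_at_right_0_antimono) (rule anti)
  also have "\<dots> \<ge> ?G \<epsilon>" by (rule SUP_upper) (use assms in simp)
  finally show ?thesis .
qed

text \<open>
  The factor contributes at most \<open>ln (t / \<alpha> + 1) / t\<close>, which tends to \<open>0\<close>. Where \<open>R t\<close> is infinite the bound
  is vacuous; this does not happen for large \<open>t\<close> if the right-hand side is less than infinity.
\<close>

lemma Limsup_log_le_of_linear_factor:
  fixes v R :: "real \<Rightarrow> enat"
  assumes "\<alpha> > 0"
    and le: "\<And>t n. t > 0 \<Longrightarrow> R t = enat n \<Longrightarrow> v t \<le> enat ((nat \<lfloor>t / \<alpha>\<rfloor> + 1) * n)"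
  shows "Limsup at_top (\<lambda>t. ereal (1 / t) * log_enat (v t))
    \<le> Limsup at_top (\<lambda>t. ereal (1 / t) * log_enat (R t))" (is "?l \<le> ?r")
proof (rule dense_ge)
  fix b assume "?r < b"
  then obtain a where a: "?r < ereal a" "ereal a < b" using ereal_dense2 by blast
  then obtain b' where b': "ereal a < ereal b'" "ereal b' < b" using ereal_dense2 by blast
  have "((\<lambda>t. ln (t / \<alpha> + 1) / t) \<longlongrightarrow> 0) at_top" using \<open>\<alpha> > 0\<close> by real_asymp
  moreover have "0 < b' - a" using b' by simp
  ultimately have "eventually (\<lambda>t. ln (t / \<alpha> + 1) / t < b' - a) at_top" by (rule order_tendstoD)
  then have "eventually (\<lambda>t. ereal (1 / t) * log_enat (v t) \<le> ereal b') at_top"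
    using Limsup_lessD[OF a(1)] eventually_gt_at_top[of 0]
  proof eventually_elim
    case (elim t)
    let ?N = "nat \<lfloor>t / \<alpha>\<rfloor> + 1"
    show ?case
    proof (cases "R t")
      case infinity
      then show ?thesis using elim by (simp add: log_enat_def)
    next
      case (enat n)
      then obtain k where k: "v t = enat k" "k \<le> ?N * n"
        using le[of t n] elim by (cases "v t") auto
      show ?thesis
      proof (cases "k = 0")
        case True
        then show ?thesis using elim k by (simp add: log_enat_def)
      next
        case False
        then have "n > 0" using k(2) by (cases n) auto
        have "real ?N \<le> t / \<alpha> + 1" using elim \<open>\<alpha> > 0\<close> by simp
        moreover have N: "0 < real ?N" unfolding of_nat_0_less_iff by simp
        ultimately have "ln (real ?N) \<le> ln (t / \<alpha> + 1)" by (simp only: ln_mono)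
        moreover have "ln (real k) \<le> ln (real (?N * n))"
          using False k(2) by (intro ln_mono) (auto simp del: of_nat_mult)
        moreover have "ln (real (?N * n)) = ln (real ?N) + ln (real n)"
          unfolding of_nat_mult using \<open>n > 0\<close> N by (intro ln_mult_pos) simp_all
        ultimately have "ln (real k) \<le> ln (t / \<alpha> + 1) + ln (real n)" by linarith
        then have "ln (real k) / t \<le> ln (t / \<alpha> + 1) / t + ln (real n) / t"
          using elim by (simp add: divide_right_mono flip: add_divide_distrib)
        moreover have "ln (real n) / t < a" using elim enat \<open>n > 0\<close> by (simp add: log_enat_def)
        ultimately have "ln (real k) / t \<le> b'" using elim by linarith
        then show ?thesis using k False by (simp add: log_enat_def)
      qed
    qed
  qed
  then have "?l \<le> ereal b'" by (rule Limsup_bounded)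
  then show "?l \<le> b" using b'(2) by (meson order.trans less_imp_le)
qed

theorem corollary1:
  fixes M :: "('a, 'e::euclidean_space) riem_mfd"
    and X :: "('a, 'e) vfield"
    and \<phi> :: "real \<Rightarrow> 'a \<Rightarrow> 'a"
  assumes "closed_riem_manifold M"
    and "C1_vector_field M X"
    and "\<exists>x\<in>points M. X x \<noteq> (\<lambda>c. 0)"
    and "flow_generated_by M X \<phi>"
    and "kstar_expansive M \<phi>"
    and "dynamically_isolated_Sing M X \<phi>"
  shows "Limsup at_top (\<lambda>t::real. ereal (1 / t) * log_enat (num_periodic_orbits M \<phi> t))
           \<le> rescaled_entropy M X \<phi>"
proof -
  interpret closed_mfd_flow M X \<phi> using assms by unfold_locales
  obtain U W where W: "openin (top_of M) W" "Sing M X \<subseteq> W" "W \<subseteq> U" "(\<Inter>t. \<phi> t ` U) = Sing M X"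
    using assms(6) unfolding dynamically_isolated_Sing_def by (elim exE conjE)
  obtain e where e: "e > 0" "\<And>p. p \<in> points M - W \<Longrightarrow> e \<le> tnorm M p (X p)"
    using speed_bounded_below[OF W(1,2)] by blast
  obtain C where C: "C > 0" "\<And>p. p \<in> points M \<Longrightarrow> tnorm M p (X p) \<le> C" using speed_bounded by blast
  obtain \<delta> where \<delta>: "\<delta> > 0" "separating \<delta>"
    using kstar_expansive_imp_separating[OF assms(5)] by blast
  \<comment> \<open>The two summands of the separation bound become at most \<open>\<delta> / 2\<close> each.\<close>
  define \<alpha> where "\<alpha> = \<delta> / (2 * C)"
  define \<epsilon> where "\<epsilon> = min e (\<delta> / (4 * C))"
  have \<alpha>: "\<alpha> > 0" "C * \<alpha> = \<delta> / 2" using \<delta>(1) C(1) by (auto simp: \<alpha>_def)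
  have \<epsilon>: "\<epsilon> > 0" "\<epsilon> \<le> e" using e(1) \<delta>(1) C(1) by (auto simp: \<epsilon>_def)
  have "\<epsilon> * C \<le> \<delta> / (4 * C) * C" using C(1) by (intro mult_right_mono) (auto simp: \<epsilon>_def)
  then have sum: "2 * (\<epsilon> * C) + C * \<alpha> \<le> \<delta>" using C(1) \<alpha>(2) by simp
  have esc: "\<exists>s. \<phi> s x \<in> speed_ge M X \<epsilon>" if x: "x \<in> points M" "is_period \<phi> x p" for x p
  proof -
    obtain s where "\<phi> s x \<notin> U" using periodic_orbit_escapes[OF W(4) x] by blast
    then have "\<phi> s x \<in> points M - W" using W(3) flow_points[OF x(1)] by blast
    then have "\<phi> s x \<in> speed_ge M X \<epsilon>" using e(2)[of "\<phi> s x"] \<epsilon>(2) by (simp add: speed_ge_def)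
    then show ?thesis by blast
  qed
  have "Limsup at_top (\<lambda>t::real. ereal (1 / t) * log_enat (num_periodic_orbits M \<phi> t))
      \<le> Limsup at_top (\<lambda>t::real. ereal (1 / t) * log_enat (min_spanning M X \<phi> t \<epsilon>))"
  proof (rule Limsup_log_le_of_linear_factor[OF \<alpha>(1)])
    fix t :: real and n assume t: "t > 0" and n: "min_spanning M X \<phi> t \<epsilon> = enat n"
    obtain F where F: "rescaled_spanning M X \<phi> t \<epsilon> F" "finite F" "card F \<le> n"
      using min_spanning_attained[OF n] by blast
    have "num_periodic_orbits M \<phi> t \<le> enat ((nat \<lfloor>t / \<alpha>\<rfloor> + 1) * card F)"
      by (rule num_periodic_orbits_le[OF \<delta>(2) C esc \<alpha>(1) \<epsilon>(1) sum F(1,2)]) (use t in auto)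
    also have "\<dots> \<le> enat ((nat \<lfloor>t / \<alpha>\<rfloor> + 1) * n)"
      using F(3) by (simp only: enat_ord_simps mult_le_mono2)
    finally show "num_periodic_orbits M \<phi> t \<le> enat ((nat \<lfloor>t / \<alpha>\<rfloor> + 1) * n)" .
  qed
  also have "\<dots> \<le> rescaled_entropy M X \<phi>" by (rule rescaled_entropy_ge[OF \<epsilon>(1)])
  finally show ?thesis .
qed

end
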